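(* Let $N\ge3$ and let $\psi=\rho^{-1}\mu_N\mu_{N-1}\cdots\mu_1\mu_{4N}\mu_{4N-1}\cdots\mu_{3N+2}\mu_{N+1}$ with $\rho=(N-1,N)(N+1,N+2,\dots,3N+1)$, acting on the cluster algebra with initial quiver $Q_{D_{2N}}$, initial mutable cluster $$(\tilde x_1,\dots,\tilde x_{4N})=(\xi_{N-2,0},\dots,\xi_{1,0},r_0,s_0,\tau_0,\tau_1,\dots,\tau_{2N},\chi_0,\eta_{1,0},\dots,\eta_{N-2,0})$$ and frozen variables $\tilde x_{4N+1}=b_5$, $\tilde x_{4N+2}=b_6$. Write $w_{2,n}=\chi_n$, $w_{k,n}=\eta_{k-2,n}$ for $3\le k\le N$, and $w_{k,n}=\xi_{2N-1-k,n}$ for $N+1\le k\le 2N-2$. (1) The iteration of the cluster map $\psi$ is equivalent to the system of recursion relations ($n\ge0$) $$\begin{aligned} \tau_{n+2N+1}\tau_n&=b_5b_6\,\tau_{n+2N-1}\tau_{n+2}+w_{2,n},\\ w_{2,n+1}w_{2,n}&=b_5b_6\,\tau_{n+2N-1}\tau_{n+2N}\tau_{n+2}\tau_{n+3}+w_{3,n}\,\tau_{n+2N+1}\tau_{n+1},\\ w_{k,n+1}w_{k,n}&=b_5b_6\,\tau_{n+2N-1}\tau_{n+2N}\tau_{n+k}\tau_{n+k+1}+w_{k-1,n+1}w_{k+1,n}\quad(3\le k\le 2N-3),\\ w_{2N-2,n+1}w_{2N-2,n}&=b_5b_6\,\tau_{n+2N-1}^2\tau_{n+2N}\tau_{n+2N-2}+w_{2N-3,n+1}\,r_ns_n,\\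 s_{n+1}r_n&=b_5\,\tau_{n+2N-1}\tau_{n+2N}+w_{2N-2,n+1},\\ r_{n+1}s_n&=b_6\,\tau_{n+2N-1}\tau_{n+2N}+w_{2N-2,n+1}, \end{aligned}$$ that is, the mutable cluster obtained after $n$ applications of $\psi$ is $(\xi_{N-2,n},\dots,\xi_{1,n},r_n,s_n,\tau_n,\dots,\tau_{n+2N},\chi_n,\eta_{1,n},\dots,\eta_{N-2,n})$. (2) Under the variable transformation $$x_{1,n}=\frac{\tau_{n+2N}\tau_n}{\tau_{n+2N-1}\tau_{n+1}},\qquad x_{k,n}=\frac{w_{k,n}}{\tau_{n+2N-1}\tau_{n+k}}\ (2\le k\le 2N-2),\qquad x_{2N-1,n}=\frac{r_n}{\tau_{n+2N-1}},\qquad x_{2N,n}=\frac{s_n}{\tau_{n+2N-1}},$$ the recursion relations in (1) reduce to $$\begin{aligned} x_{1,n+1}x_{1,n}&=b_5b_6+x_{2,n},\\ x_{k,n+1}x_{k,n}&=b_5b_6+x_{k+1,n}x_{k-1,n+1}\quad(2\le k\le 2N-3),\\ x_{2N-2,n+1}x_{2N-2,n}&=b_5b_6+x_{2N-1,n}x_{2N,n}x_{2N-3,n+1},\\ x_{2N-1,n+1}x_{2N-1,n}&=b_5+x_{2N-2,n+1},\\ x_{2N,n+1}x_{2N,n}&=b_6+x_{2N-2,n+1}, \end{aligned}$$ which is the deformed type $D_{2N}$ map. Thus the deformed type $D_{2N}$ map can be expressed as a cluster map defined by cluster mutations in the cluster algebra whose initial seed consists of the cluster $(\tilde x_1,\dots,\tilde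 x_{4N})$ and the quiver $Q_{D_{2N}}$.
   Context: Cluster conventions. Mutations compose from right to left (first $\mu_{N+1}$, then $\mu_{3N+2},\dots,\mu_{4N}$, then $\mu_1,\dots,\mu_N$). Quiver mutation at a mutable node $k$: for each path $i\to k\to j$ add an arrow $i\to j$; reverse all arrows incident to $k$; cancel 2-cycles. At the same time $\tilde x_k$ is replaced by $\tilde x_k'$ with $\tilde x_k'\tilde x_k=\prod_{i\to k}\tilde x_i+\prod_{k\to j}\tilde x_j$ (products over arrows with multiplicity, frozen nodes included). Applying $\rho^{-1}$ means relabelling: if the cluster after the mutations is $(\tilde x_i')$, the new cluster is $(\tilde x'_{\rho(i)})_i$, and the new quiver has an arrow $i\to j$ whenever the mutated quiver has an arrow $\rho(i)\to\rho(j)$ (frozen nodes are fixed by $\rho$). Here $\rho$ exchanges $N-1$ and $N$ and maps $N+1\mapsto N+2\mapsto\cdots\mapsto3N+1\mapsto N+1$. A cluster map is such a composition that returns the quiver to its original form, so that it can be iterated as a birational map on clusters. The deformed type $D_{2N}$ map is obtained from the type $D_{2N}$ cluster map (composition of mutations $\mu_{2N}\cdots\mu_1$ in the type $D_{2N}$ cluster algebra) by inserting constant parameters into the exchange relations. Definition of $Q_{D_{2N}}$. It has mutable nodes $1,\dots,4N$ and two frozen nodes $4N+1,4N+2$. Put $t_k=N+1+k$ for $0\le k\le 2N$; $c_k=3N+k$ for $2\le k\le N$ and $c_k=k-N$ for $N+1\le k\le 2N-2$; the two remaining mutable nodes are $N-1$ and $N$. The arrows (each of multiplicity one) are: - $t_k\to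 t_{k+1}$ for $1\le k\le 2N-1$; - $c_k\to c_{k+1}$ for $2\le k\le 2N-3$; - $c_k\to t_{k-1}$ and $t_{k+1}\to c_k$ for $2\le k\le 2N-2$; - $c_{2N-2}\to N-1$ and $c_{2N-2}\to N$; - $N-1\to t_{2N-2}$, $N\to t_{2N-2}$, $N-1\to t_{2N-1}$, $N\to t_{2N-1}$; - $t_0\to c_2$, $t_{2N}\to c_2$, $t_2\to t_0$, $t_2\to t_{2N}$, $t_{2N-1}\to t_0$, $t_1\to t_{2N-1}$; - $4N+1\to t_0$, $4N+2\to t_0$, $N\to 4N+1$, $N-1\to 4N+2$. With this labelling, the initial variable at node $t_k$ is $\tau_k$, at node $c_k$ it is $w_{k,0}$, at node $N-1$ it is $r_0$ and at node $N$ it is $s_0$.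
   Formalization: In (2) the last two relations are corrected to x_{2N,n+1}x_{2N-1,n}=b_5+x_{2N-2,n+1} and x_{2N-1,n+1}x_{2N,n}=b_6+x_{2N-2,n+1}; so ψ realizes the deformed D_{2N} map followed by exchanging its last two coordinates (as printed, (1) would force r_1=s_1). *)

theory Defs
  imports
    Complex_Main
    "HOL-Library.Poly_Mapping"
    "HOL-Computational_Algebra.Fraction_Field"
    "HOL-Combinatorics.Transposition"
begin

(* The ambient field of the cluster algebra: rational functions over the rationals in
   indeterminates indexed by the nodes.  Frozen variables are indeterminates as well. *)
type_synonym ratfun = "((nat \<Rightarrow>\<^sub>0 nat) \<Rightarrow>\<^sub>0 rat) fract"

definition indet :: "nat \<Rightarrow> ratfun" where
  "indet i = Fract (Poly_Mapping.single (Poly_Mapping.single i 1) 1) 1"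

(* q i j is the number of arrows i \<rightarrow> j *)
type_synonym quiver = "nat \<Rightarrow> nat \<Rightarrow> nat"

type_synonym 'a seed = "quiver \<times> (nat \<Rightarrow> 'a)"

(* Truncated subtraction on nat removes a maximal collection of 2-cycles. *)
definition cancel_2cycles :: "quiver \<Rightarrow> quiver" where
  "cancel_2cycles q = (\<lambda>i j. q i j - q j i)"

definition mutate_quiver :: "nat \<Rightarrow> quiver \<Rightarrow> quiver" where
  "mutate_quiver k q =
     cancel_2cycles (\<lambda>i j. if i = k \<or> j = k then q j i else q i j + q i k * q k j)"

(* Mutation at k with parameters inserted into the exchange relation:
   x_k' x_k = a_k * (product over arrows i \<rightarrow> k) + d_k * (product over arrows k \<rightarrow> j).
   V is the set of nodes, frozen ones included. *)
fun deformed_mutate ::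
  "nat set \<Rightarrow> (nat \<Rightarrow> 'a::field) \<Rightarrow> (nat \<Rightarrow> 'a) \<Rightarrow> nat \<Rightarrow> 'a seed \<Rightarrow> 'a seed" where
  "deformed_mutate V a d k (q, x) =
     (mutate_quiver k q,
      x(k := (a k * (\<Prod>i\<in>V. x i ^ q i k) + d k * (\<Prod>j\<in>V. x j ^ q k j)) / x k))"

fun mutate :: "nat set \<Rightarrow> nat \<Rightarrow> 'a::field seed \<Rightarrow> 'a seed" where
  "mutate V k (q, x) =
     (mutate_quiver k q,
      x(k := ((\<Prod>i\<in>V. x i ^ q i k) + (\<Prod>j\<in>V. x j ^ q k j)) / x k))"

fun relabel :: "(nat \<Rightarrow> nat) \<Rightarrow> 'a seed \<Rightarrow> 'a seed" where
  "relabel p (q, x) = ((\<lambda>i j. q (p i) (p j)), (\<lambda>i. x (p i)))"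

definition t_node :: "nat \<Rightarrow> nat \<Rightarrow> nat" where
  "t_node N k = N + 1 + k"

definition c_node :: "nat \<Rightarrow> nat \<Rightarrow> nat" where
  "c_node N k = (if k \<le> N then 3 * N + k else k - N)"

definition QD_arrows :: "nat \<Rightarrow> (nat \<times> nat) set" where
  "QD_arrows N = (let t = t_node N; c = c_node N in
     {(t k, t (k + 1)) |k. 1 \<le> k \<and> k \<le> 2 * N - 1}
   \<union> {(c k, c (k + 1)) |k. 2 \<le> k \<and> k \<le> 2 * N - 3}
   \<union> {(c k, t (k - 1)) |k. 2 \<le> k \<and> k \<le> 2 * N - 2}
   \<union> {(t (k + 1), c k) |k. 2 \<le> k \<and> k \<le> 2 * N - 2}
   \<union> {(c (2 * N - 2), N - 1), (c (2 * N - 2), N)}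
   \<union> {(N - 1, t (2 * N - 2)), (N, t (2 * N - 2)), (N - 1, t (2 * N - 1)), (N, t (2 * N - 1))}
   \<union> {(t 0, c 2), (t (2 * N), c 2), (t 2, t 0), (t 2, t (2 * N)),
      (t (2 * N - 1), t 0), (t 1, t (2 * N - 1))}
   \<union> {(4 * N + 1, t 0), (4 * N + 2, t 0), (N, 4 * N + 1), (N - 1, 4 * N + 2)})"

definition QD :: "nat \<Rightarrow> quiver" where
  "QD N i j = of_bool ((i, j) \<in> QD_arrows N)"

definition init_seed :: "nat \<Rightarrow> ratfun seed" where
  "init_seed N = (QD N, indet)"

definition rho :: "nat \<Rightarrow> nat \<Rightarrow> nat" where
  "rho N i =
     (if i = N - 1 then N
      else if i = N then N - 1
      else if N + 1 \<le> i \<and> i \<le> 3 * N then i + 1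
      else if i = 3 * N + 1 then N + 1
      else i)"

(* fold applies the mutations in list order; relabel (rho N) is the action of rho^{-1}. *)
definition psi :: "nat \<Rightarrow> 'a::field seed \<Rightarrow> 'a seed" where
  "psi N S =
     relabel (rho N)
       (fold (mutate {1..4 * N + 2}) ([N + 1] @ [3 * N + 2..<4 * N + 1] @ [1..<N + 1]) S)"

definition cluster_after :: "nat \<Rightarrow> nat \<Rightarrow> nat \<Rightarrow> ratfun" where
  "cluster_after N n = snd ((psi N ^^ n) (init_seed N))"

definition quiver_after :: "nat \<Rightarrow> nat \<Rightarrow> quiver" where
  "quiver_after N n = fst ((psi N ^^ n) (init_seed N))"

definition w_of ::
  "nat \<Rightarrow> (nat \<Rightarrow> 'a) \<Rightarrow> (nat \<Rightarrow> nat \<Rightarrow> 'a) \<Rightarrow> (nat \<Rightarrow> nat \<Rightarrow> 'a) \<Rightarrow> nat \<Rightarrow> nat \<Rightarrow> 'a" where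
  "w_of N \<chi> \<eta> \<xi> k n =
     (if k = 2 then \<chi> n else if k \<le> N then \<eta> (k - 2) n else \<xi> (2 * N - 1 - k) n)"

definition cluster_tuple ::
  "nat \<Rightarrow> (nat \<Rightarrow> nat \<Rightarrow> 'a) \<Rightarrow> (nat \<Rightarrow> 'a) \<Rightarrow> (nat \<Rightarrow> 'a) \<Rightarrow> (nat \<Rightarrow> 'a) \<Rightarrow> (nat \<Rightarrow> 'a)
     \<Rightarrow> (nat \<Rightarrow> nat \<Rightarrow> 'a) \<Rightarrow> nat \<Rightarrow> 'a list" where
  "cluster_tuple N \<xi> r s \<tau> \<chi> \<eta> n =
     map (\<lambda>j. \<xi> j n) (rev [1..<N - 1]) @ [r n, s n] @ map (\<lambda>j. \<tau> (n + j)) [0..<2 * N + 1]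
       @ [\<chi> n] @ map (\<lambda>j. \<eta> j n) [1..<N - 1]"

definition tau_recursion ::
  "nat \<Rightarrow> 'a::field \<Rightarrow> 'a \<Rightarrow> (nat \<Rightarrow> 'a) \<Rightarrow> (nat \<Rightarrow> nat \<Rightarrow> 'a) \<Rightarrow> (nat \<Rightarrow> 'a) \<Rightarrow> (nat \<Rightarrow> 'a) \<Rightarrow> bool"
  where
  "tau_recursion N b5 b6 \<tau> w r s \<longleftrightarrow> (\<forall>n.
     \<tau> (n + 2*N + 1) * \<tau> n = b5 * b6 * \<tau> (n + 2*N - 1) * \<tau> (n + 2) + w 2 n
   \<and> w 2 (n + 1) * w 2 n =
       b5 * b6 * \<tau> (n + 2*N - 1) * \<tau> (n + 2*N) * \<tau> (n + 2) * \<tau> (n + 3)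
         + w 3 n * \<tau> (n + 2*N + 1) * \<tau> (n + 1)
   \<and> (\<forall>k. 3 \<le> k \<and> k \<le> 2*N - 3 \<longrightarrow>
       w k (n + 1) * w k n =
         b5 * b6 * \<tau> (n + 2*N - 1) * \<tau> (n + 2*N) * \<tau> (n + k) * \<tau> (n + k + 1)
           + w (k - 1) (n + 1) * w (k + 1) n)
   \<and> w (2*N - 2) (n + 1) * w (2*N - 2) n =
       b5 * b6 * (\<tau> (n + 2*N - 1))\<^sup>2 * \<tau> (n + 2*N) * \<tau> (n + 2*N - 2)
         + w (2*N - 3) (n + 1) * r n * s n
   \<and> s (n + 1) * r n = b5 * \<tau> (n + 2*N - 1) * \<tau> (n + 2*N) + w (2*N - 2) (n + 1)
   \<and> r (n + 1) * s n = b6 * \<tau> (n + 2*N - 1) * \<tau> (n + 2*N) + w (2*N - 2) (n + 1))"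

definition x_of ::
  "nat \<Rightarrow> (nat \<Rightarrow> 'a::field) \<Rightarrow> (nat \<Rightarrow> nat \<Rightarrow> 'a) \<Rightarrow> (nat \<Rightarrow> 'a) \<Rightarrow> (nat \<Rightarrow> 'a) \<Rightarrow> nat \<Rightarrow> nat \<Rightarrow> 'a"
  where
  "x_of N \<tau> w r s n k =
     (if k = 1 then \<tau> (n + 2*N) * \<tau> n / (\<tau> (n + 2*N - 1) * \<tau> (n + 1))
      else if k \<le> 2*N - 2 then w k n / (\<tau> (n + 2*N - 1) * \<tau> (n + k))
      else if k = 2*N - 1 then r n / \<tau> (n + 2*N - 1)
      else s n / \<tau> (n + 2*N - 1))"

(* The same change of variables, as a map on clusters. *)
definition x_of_cluster :: "nat \<Rightarrow> (nat \<Rightarrow> 'a::field) \<Rightarrow> nat \<Rightarrow> 'a" where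
  "x_of_cluster N z =
     x_of N (\<lambda>j. z (t_node N j)) (\<lambda>k _. z (c_node N k)) (\<lambda>_. z (N - 1)) (\<lambda>_. z N) 0"

(* One step x \<mapsto> x' of the x-system, in implicit form. *)
definition D_relations ::
  "nat \<Rightarrow> 'a::field \<Rightarrow> 'a \<Rightarrow> (nat \<Rightarrow> 'a) \<Rightarrow> (nat \<Rightarrow> 'a) \<Rightarrow> bool" where
  "D_relations N b5 b6 x x' \<longleftrightarrow>
     x' 1 * x 1 = b5 * b6 + x 2
   \<and> (\<forall>k. 2 \<le> k \<and> k \<le> 2*N - 3 \<longrightarrow> x' k * x k = b5 * b6 + x (k + 1) * x' (k - 1))
   \<and> x' (2*N - 2) * x (2*N - 2) = b5 * b6 + x (2*N - 1) * x (2*N) * x' (2*N - 3)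
   \<and> x' (2*N - 1) * x (2*N - 1) = b5 + x' (2*N - 2)
   \<and> x' (2*N) * x (2*N) = b6 + x' (2*N - 2)"

(* Dynkin diagram D_M, oriented 1 \<rightarrow> 2 \<rightarrow> ... \<rightarrow> M-2 with M-2 \<rightarrow> M-1 and M-2 \<rightarrow> M. *)
definition D_quiver :: "nat \<Rightarrow> quiver" where
  "D_quiver M i j =
     of_bool ((1 \<le> i \<and> i \<le> M - 2 \<and> j = i + 1) \<or> (i = M - 2 \<and> j = M))"

definition deformed_D_map ::
  "nat \<Rightarrow> (nat \<Rightarrow> 'a::field) \<Rightarrow> (nat \<Rightarrow> 'a) \<Rightarrow> (nat \<Rightarrow> 'a) \<Rightarrow> nat \<Rightarrow> 'a" where
  "deformed_D_map M a d x =
     snd (fold (deformed_mutate {1..M} a d) [1..<M + 1] (D_quiver M, x))"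

definition D_params :: "nat \<Rightarrow> 'a::field \<Rightarrow> 'a \<Rightarrow> nat \<Rightarrow> 'a" where
  "D_params N b5 b6 k =
     (if k \<le> 2*N - 2 then b5 * b6 else if k = 2*N - 1 then b5 else b6)"

(* Exchange of the last two coordinates x_{2N-1} and x_{2N}.  It is needed because rho exchanges
   the nodes N-1 and N: the new variable obtained by mutating r_n is s_{n+1}, and the one obtained
   by mutating s_n is r_{n+1}. *)
definition swap_last :: "nat \<Rightarrow> (nat \<Rightarrow> 'a) \<Rightarrow> nat \<Rightarrow> 'a" where
  "swap_last N x = x \<circ> transpose (2*N - 1) (2*N)"

end

(* The cluster part rests on explicit quivers.  After mutating t_0, c_2, ..., c_m the quiver differs
   from Q_{D_2N} only near a front that travels along the chain of the c-nodes, so a closed form is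
   available at every stage; each mutation is then a local check, and after the last one relabelling
   by rho gives back Q_{D_2N}.  Each mutation in psi is performed at a different node, so the new
   variables are given by the recursion relations.  All cluster variables are quotients of nonzero
   polynomials with nonnegative coefficients, hence nonzero, so that the recursion determines them.
   In the type D_2N algebra, every mutation happens at a source, hence only reverses arrows. *)
theory Submission
  imports Defs
begin

section \<open>Quivers along the mutation sequence\<close>

text \<open>The numeric labels cut the chain c_2, c_3, ... into two blocks at opposite ends of the
  label range, and arrows have to be compared for arbitrary N. Symbolic nodes make the chain uniform
  and reduce equality of nodes to constructors and indices; \<open>pull\<close> carries the results
  back to numeric quivers. Each neighbour list of a mutated node serves twice: it governs the change
  of arrows and, read as a product, it is a monomial of the exchange relation. Hence r_n is paired
  with s_{n+1}, and the x-system is compared with the deformed map after a swap of the last two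
  coordinates. A single step of \<open>psi\<close> is computed in quotient form for arbitrary field
  values. Non-vanishing enters where denominators are cleared and where a relation is solved for its
  new variable.\<close>

datatype node = T nat | C nat | R | S | F5 | F6 | X nat

text \<open>The closed forms are parametrised by \<open>M = 2N - 2\<close>, which keeps truncated subtraction out of them.
  The arrows among the \<open>t_k\<close> reach their final form \<open>TT\<close> already with the mutation at \<open>c_2\<close>.
  \<open>Q0\<close> is the initial quiver; \<open>Q1\<close>, \<open>Qm M m\<close>, \<open>QA\<close>, \<open>QB\<close>, \<open>QC\<close> are
  the quivers after the mutation at \<open>t_0\<close>, at \<open>c_m\<close> with \<open>m < M\<close>, at \<open>c_M\<close>,
  at \<open>N - 1\<close> (node \<open>R\<close>) and at \<open>N\<close> (node \<open>S\<close>), respectively.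
  The constructor \<open>X\<close> makes the labelling of all natural numbers injective.\<close>

definition Q0 :: "nat \<Rightarrow> node \<Rightarrow> node \<Rightarrow> nat" where
  "Q0 M x y = (case x of
     T i \<Rightarrow> (case y of
         T j \<Rightarrow> of_bool (1 \<le> i \<and> j = i + 1 \<and> j \<le> M+2 \<or> i = 2 \<and> (j = 0 \<or> j = M+2)
                       \<or> i = M+1 \<and> j = 0 \<or> i = 1 \<and> j = M+1)
       | C j \<Rightarrow> of_bool (2 \<le> j \<and> j \<le> M \<and> i = j + 1 \<or> j = 2 \<and> (i = 0 \<or> i = M+2))
       | _ \<Rightarrow> 0)
   | C i \<Rightarrow> (case y of
         T j \<Rightarrow> of_bool (2 \<le> i \<and> i \<le> M \<and> i = j + 1)
       | C j \<Rightarrow> of_bool (2 \<le> i \<and> j = i + 1 \<and> j \<le> M)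
       | R \<Rightarrow> of_bool (i = M) | S \<Rightarrow> of_bool (i = M) | _ \<Rightarrow> 0)
   | R \<Rightarrow> (case y of T j \<Rightarrow> of_bool (j = M \<or> j = M+1) | F6 \<Rightarrow> 1 | _ \<Rightarrow> 0)
   | S \<Rightarrow> (case y of T j \<Rightarrow> of_bool (j = M \<or> j = M+1) | F5 \<Rightarrow> 1 | _ \<Rightarrow> 0)
   | F5 \<Rightarrow> (case y of T j \<Rightarrow> of_bool (j = 0) | _ \<Rightarrow> 0)
   | F6 \<Rightarrow> (case y of T j \<Rightarrow> of_bool (j = 0) | _ \<Rightarrow> 0)
   | X i \<Rightarrow> 0)"

definition Q1 :: "nat \<Rightarrow> node \<Rightarrow> node \<Rightarrow> nat" where
  "Q1 M x y = (case x of
     T i \<Rightarrow> (case y of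
         T j \<Rightarrow> of_bool (1 \<le> i \<and> j = i + 1 \<and> j \<le> M+2 \<or> i = 2 \<and> j = M+2
                       \<or> i = 0 \<and> (j = 2 \<or> j = M+1) \<or> i = 1 \<and> j = M+1)
       | C j \<Rightarrow> of_bool (2 \<le> j \<and> j \<le> M \<and> i = j + 1
                       \<or> j = 2 \<and> (i = 2 \<or> i = M+1 \<or> i = M+2))
       | F5 \<Rightarrow> of_bool (i = 0) | F6 \<Rightarrow> of_bool (i = 0) | _ \<Rightarrow> 0)
   | C i \<Rightarrow> (case y of
         T j \<Rightarrow> of_bool (2 \<le> i \<and> i \<le> M \<and> i = j + 1 \<or> i = 2 \<and> j = 0)
       | C j \<Rightarrow> of_bool (2 \<le> i \<and> j = i + 1 \<and> j \<le> M)
       | R \<Rightarrow> of_bool (i = M) | S \<Rightarrow> of_bool (i = M) | _ \<Rightarrow> 0)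
   | R \<Rightarrow> (case y of T j \<Rightarrow> of_bool (j = M \<or> j = M+1) | F6 \<Rightarrow> 1 | _ \<Rightarrow> 0)
   | S \<Rightarrow> (case y of T j \<Rightarrow> of_bool (j = M \<or> j = M+1) | F5 \<Rightarrow> 1 | _ \<Rightarrow> 0)
   | F5 \<Rightarrow> (case y of C j \<Rightarrow> of_bool (j = 2) | _ \<Rightarrow> 0)
   | F6 \<Rightarrow> (case y of C j \<Rightarrow> of_bool (j = 2) | _ \<Rightarrow> 0)
   | X i \<Rightarrow> 0)"

definition TT :: "nat \<Rightarrow> nat \<Rightarrow> nat \<Rightarrow> nat" where
  "TT M i j = of_bool (2 \<le> i \<and> j = i + 1 \<and> j \<le> M+2 \<or> i = 2 \<and> j = M+2
                       \<or> i = 3 \<and> j \<le> 1 \<or> i = M+2 \<and> j \<le> 1)"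

definition Qm :: "nat \<Rightarrow> nat \<Rightarrow> node \<Rightarrow> node \<Rightarrow> nat" where
  "Qm M m x y = (case x of
     T i \<Rightarrow> (case y of
         T j \<Rightarrow> TT M i j
       | C j \<Rightarrow> of_bool (2 \<le> j \<and> j < m \<and> i = j + 2 \<or> m < j \<and> j \<le> M \<and> i = j + 1
                       \<or> j = m + 1 \<and> (i = m + 1 \<or> i = M+2) \<or> j = 2 \<and> i \<le> 1)
                + of_bool (j = m + 1 \<and> i = M+1)
       | _ \<Rightarrow> 0)
   | C i \<Rightarrow> (case y of
         T j \<Rightarrow> of_bool (2 \<le> i \<and> i \<le> m \<and> j = i \<or> m + 2 \<le> i \<and> i \<le> M \<and> i = j + 1
                       \<or> i = m \<and> (j = m + 1 \<or> j = M+1 \<or> j = M+2))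
       | C j \<Rightarrow> of_bool (2 \<le> i \<and> j = i + 1 \<and> j \<le> M \<and> i \<noteq> m \<or> i = m + 1 \<and> j = m)
       | R \<Rightarrow> of_bool (i = M) | S \<Rightarrow> of_bool (i = M)
       | F5 \<Rightarrow> of_bool (i = m) | F6 \<Rightarrow> of_bool (i = m) | _ \<Rightarrow> 0)
   | R \<Rightarrow> (case y of T j \<Rightarrow> of_bool (j = M \<or> j = M+1) | F6 \<Rightarrow> 1 | _ \<Rightarrow> 0)
   | S \<Rightarrow> (case y of T j \<Rightarrow> of_bool (j = M \<or> j = M+1) | F5 \<Rightarrow> 1 | _ \<Rightarrow> 0)
   | F5 \<Rightarrow> (case y of C j \<Rightarrow> of_bool (j = m + 1) | T j \<Rightarrow> of_bool (j = 1) | _ \<Rightarrow> 0)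
   | F6 \<Rightarrow> (case y of C j \<Rightarrow> of_bool (j = m + 1) | T j \<Rightarrow> of_bool (j = 1) | _ \<Rightarrow> 0)
   | X i \<Rightarrow> 0)"

definition QA :: "nat \<Rightarrow> node \<Rightarrow> node \<Rightarrow> nat" where
  "QA M x y = (case x of
     T i \<Rightarrow> (case y of
         T j \<Rightarrow> TT M i j
       | C j \<Rightarrow> of_bool (2 \<le> j \<and> j < M \<and> i = j + 2 \<or> j = 2 \<and> i \<le> 1)
       | R \<Rightarrow> of_bool (i = M+1 \<or> i = M+2) | S \<Rightarrow> of_bool (i = M+1 \<or> i = M+2)
       | _ \<Rightarrow> 0)
   | C i \<Rightarrow> (case y of
         T j \<Rightarrow> of_bool (2 \<le> i \<and> i \<le> M \<and> j = i \<or> i = M \<and> j = M+2)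
                + 2 * of_bool (i = M \<and> j = M+1)
       | C j \<Rightarrow> of_bool (2 \<le> i \<and> j = i + 1 \<and> j \<le> M)
       | F5 \<Rightarrow> of_bool (i = M) | F6 \<Rightarrow> of_bool (i = M) | _ \<Rightarrow> 0)
   | R \<Rightarrow> (case y of C j \<Rightarrow> of_bool (j = M) | _ \<Rightarrow> 0)
   | S \<Rightarrow> (case y of C j \<Rightarrow> of_bool (j = M) | _ \<Rightarrow> 0)
   | F5 \<Rightarrow> (case y of R \<Rightarrow> 1 | T j \<Rightarrow> of_bool (j = 1) | _ \<Rightarrow> 0)
   | F6 \<Rightarrow> (case y of S \<Rightarrow> 1 | T j \<Rightarrow> of_bool (j = 1) | _ \<Rightarrow> 0)
   | X i \<Rightarrow> 0)"

definition QB :: "nat \<Rightarrow> node \<Rightarrow> node \<Rightarrow> nat" where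
  "QB M x y = (case x of
     T i \<Rightarrow> (case y of
         T j \<Rightarrow> TT M i j
       | C j \<Rightarrow> of_bool (2 \<le> j \<and> j < M \<and> i = j + 2 \<or> j = 2 \<and> i \<le> 1)
       | S \<Rightarrow> of_bool (i = M+1 \<or> i = M+2)
       | _ \<Rightarrow> 0)
   | C i \<Rightarrow> (case y of
         T j \<Rightarrow> of_bool (2 \<le> i \<and> i \<le> M \<and> j = i \<or> i = M \<and> j = M+1)
       | C j \<Rightarrow> of_bool (2 \<le> i \<and> j = i + 1 \<and> j \<le> M)
       | R \<Rightarrow> of_bool (i = M) | F6 \<Rightarrow> of_bool (i = M) | _ \<Rightarrow> 0)
   | R \<Rightarrow> (case y of T j \<Rightarrow> of_bool (j = M+1 \<or> j = M+2) | F5 \<Rightarrow> 1 | _ \<Rightarrow> 0)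
   | S \<Rightarrow> (case y of C j \<Rightarrow> of_bool (j = M) | _ \<Rightarrow> 0)
   | F5 \<Rightarrow> (case y of T j \<Rightarrow> of_bool (j = 1) | _ \<Rightarrow> 0)
   | F6 \<Rightarrow> (case y of S \<Rightarrow> 1 | T j \<Rightarrow> of_bool (j = 1) | _ \<Rightarrow> 0)
   | X i \<Rightarrow> 0)"

definition QC :: "nat \<Rightarrow> node \<Rightarrow> node \<Rightarrow> nat" where
  "QC M x y = (case x of
     T i \<Rightarrow> (case y of
         T j \<Rightarrow> TT M i j
       | C j \<Rightarrow> of_bool (2 \<le> j \<and> j \<le> M \<and> i = j + 2 \<or> j = 2 \<and> i \<le> 1)
       | _ \<Rightarrow> 0)
   | C i \<Rightarrow> (case y of
         T j \<Rightarrow> of_bool (2 \<le> i \<and> i \<le> M \<and> j = i)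
       | C j \<Rightarrow> of_bool (2 \<le> i \<and> j = i + 1 \<and> j \<le> M)
       | R \<Rightarrow> of_bool (i = M) | S \<Rightarrow> of_bool (i = M) | _ \<Rightarrow> 0)
   | R \<Rightarrow> (case y of T j \<Rightarrow> of_bool (j = M + 1 \<or> j = M + 2) | F5 \<Rightarrow> 1 | _ \<Rightarrow> 0)
   | S \<Rightarrow> (case y of T j \<Rightarrow> of_bool (j = M + 1 \<or> j = M + 2) | F6 \<Rightarrow> 1 | _ \<Rightarrow> 0)
   | F5 \<Rightarrow> (case y of T j \<Rightarrow> of_bool (j = 1) | _ \<Rightarrow> 0)
   | F6 \<Rightarrow> (case y of T j \<Rightarrow> of_bool (j = 1) | _ \<Rightarrow> 0)
   | X i \<Rightarrow> 0)"

section \<open>A local criterion for mutation of symbolic quivers\<close>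

definition nmut :: "node \<Rightarrow> (node \<Rightarrow> node \<Rightarrow> nat) \<Rightarrow> node \<Rightarrow> node \<Rightarrow> nat" where
  "nmut v q x y = (if x = v \<or> y = v then q y x - q x y
                   else (q x y + q x v * q v y) - (q y x + q y v * q v x))"

text \<open>Neighbours are listed with multiplicity because the same lists become the monomials of
  the exchange relation in \<open>mutate_pull\<close>.\<close>

definition rowcol :: "(node \<Rightarrow> node \<Rightarrow> nat) \<Rightarrow> node \<Rightarrow> node list \<Rightarrow> node list \<Rightarrow> bool" where
  "rowcol q v ins outs \<longleftrightarrow> (\<forall>x. q x v = count_list ins x \<and> q v x = count_list outs x)"

definition no_2cycles :: "(node \<Rightarrow> node \<Rightarrow> nat) \<Rightarrow> bool" where
  "no_2cycles q \<longleftrightarrow> (\<forall>x y. q x y = 0 \<or> q y x = 0)"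

text \<open>Besides the row and column of \<open>v\<close>, a mutation can change only entries
  between an in-neighbour and an out-neighbour. For those, \<open>io\<close> asks for the net number
  of arrows, as an additive identity that avoids truncated subtraction, and for the absence of a
  2-cycle; together these fix both entries. The second conclusion supplies the hypothesis for the
  next mutation.\<close>

lemma nmut_eqI:
  assumes rc: "rowcol q v ins outs" and q: "no_2cycles q"
    and v: "\<And>y. q' v y = count_list ins y" "\<And>y. q' y v = count_list outs y"
    and io: "\<forall>x\<in>set ins. \<forall>y\<in>set outs.
        q' x y + q y x = q x y + count_list ins x * count_list outs y + q' y x \<and> (q' x y = 0 \<or> q' y x = 0)"
    and other: "\<And>x y. x \<noteq> v \<Longrightarrow> y \<noteq> v \<Longrightarrow> x \<in> set ins \<longrightarrow> y \<notin> set outs \<Longrightarrow> y \<in> set ins \<longrightarrow> x \<notin> set outs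
       \<Longrightarrow> q' x y = q x y"
  shows "nmut v q = q'" "no_2cycles q'"
proof -
  \<comment> \<open>A node in both lists would form a 2-cycle with \<open>v\<close>.\<close>
  have disj: "set ins \<inter> set outs = {}"
    using rc q unfolding rowcol_def no_2cycles_def by (metis count_list_0_iff disjoint_iff)
  have D: "count_list ins y - count_list outs y = count_list ins y"
     "count_list outs y - count_list ins y = count_list outs y" for y
    using disj by (metis count_list_0_iff diff_zero diff_0_eq_0 disjoint_iff)+
  have Z: "count_list ins x = 0" if "x \<notin> set ins" for x using that by (simp add: count_list_0_iff)
  have Z': "count_list outs x = 0" if "x \<notin> set outs" for x using that by (simp add: count_list_0_iff)
  show *: "nmut v q = q'"
  proof (intro ext)
    fix x y
    consider "x = v \<or> y = v" | "x \<noteq> v" "y \<noteq> v" "x \<in> set ins" "y \<in> set outs"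
      | "x \<noteq> v" "y \<noteq> v" "y \<in> set ins" "x \<in> set outs"
      | "x \<noteq> v" "y \<noteq> v" "x \<in> set ins \<longrightarrow> y \<notin> set outs" "y \<in> set ins \<longrightarrow> x \<notin> set outs"
      by blast
    then show "nmut v q x y = q' x y"
    proof cases
      case 1 then show ?thesis using rc v D by (auto simp: nmut_def rowcol_def)
    next
      case 2
      then have "x \<notin> set outs" using disj by auto
      with 2 io[rule_format, of x y] rc show ?thesis
        by (auto simp: nmut_def rowcol_def Z')
    next
      case 3
      then have "y \<notin> set outs" using disj by auto
      with 3 io[rule_format, of y x] rc show ?thesis
        by (auto simp: nmut_def rowcol_def Z')
    next
      case 4
      have "count_list ins x * count_list outs y = 0" "count_list ins y * count_list outs x = 0"
        using 4 Z Z' by auto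
      moreover have "q x y - q y x = q x y" using q unfolding no_2cycles_def by (metis diff_zero diff_0_eq_0)
      ultimately show ?thesis using 4 rc other by (auto simp: nmut_def rowcol_def)
    qed
  qed
  \<comment> \<open>The truncated differences \<open>a - b\<close> and \<open>b - a\<close> are
    never both positive.\<close>
  show "no_2cycles q'" unfolding no_2cycles_def *[symmetric] by (auto simp: nmut_def)
qed

section \<open>Neighbours of the mutated nodes and the effect of each mutation\<close>

lemma no_2cycles_Q0: "M \<ge> 4 \<Longrightarrow> no_2cycles (Q0 M)"
  unfolding no_2cycles_def
  apply (intro allI)
  subgoal for x y by (cases x; cases y) (auto simp: Q0_def)
  done

text \<open>Read as monomials, with M + 1 = 2N - 1, the lists are b_5 b_6 tau_2 tau_{2N-1} and w_2,
  the two terms of the first recursion. The lists below yield the other recursions in the same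
  way.\<close>

lemma rowcol_Q0: "M \<ge> 4 \<Longrightarrow> rowcol (Q0 M) (T 0) [T 2, T (M+1), F5, F6] [C 2]"
  unfolding rowcol_def
  apply (intro allI)
  subgoal for x by (cases x) (auto simp: Q0_def)
  done

lemma rowcol_Q1: "M \<ge> 4 \<Longrightarrow> rowcol (Q1 M) (C 2) [T 2, T 3, T (M+1), T (M+2), F5, F6] [T 0, T 1, C 3]"
  unfolding rowcol_def
  apply (intro allI)
  subgoal for x by (cases x) (auto simp: Q1_def)
  done

text \<open>The out-neighbours at the front are the c-node just mutated, which will enter the
  exchange relation with its new value, and the next c-node, replaced by \<open>R\<close> and
  \<open>S\<close> at the end of the chain.\<close>

lemma rowcol_Qm: "2 \<le> m \<Longrightarrow> m < M \<Longrightarrow> rowcol (Qm M m) (C (Suc m))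
    [T (Suc m), T (m+2), T (M+1), T (M+2), F5, F6] (C m # (if Suc m = M then [R, S] else [C (m+2)]))"
  unfolding rowcol_def
  apply (intro allI)
  subgoal for x by (cases x) (auto simp: Qm_def)
  done

lemma rowcol_QA: "M \<ge> 4 \<Longrightarrow> rowcol (QA M) R [T (M+1), T (M+2), F5] [C M]"
  unfolding rowcol_def
  apply (intro allI)
  subgoal for x by (cases x) (auto simp: QA_def)
  done

lemma rowcol_QB: "M \<ge> 4 \<Longrightarrow> rowcol (QB M) S [T (M+1), T (M+2), F6] [C M]"
  unfolding rowcol_def
  apply (intro allI)
  subgoal for x by (cases x) (auto simp: QB_def)
  done

text \<open>At the end of the chain the neighbours \<open>T (m+2)\<close> and \<open>T (M+1)\<close>
  merge into a double arrow, the origin of the square in the recursion for w_{2N-2}. The separate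
  summand in \<open>Qm\<close> counts its second copy.\<close>

lemma rowcol_Qm_last: "M \<ge> 4 \<Longrightarrow> M = Suc m \<Longrightarrow> rowcol (Qm M m) (C M)
    [T M, T (M+1), T (M+1), T (M+2), F5, F6] [C m, R, S]"
  unfolding rowcol_def
  apply (intro allI)
  subgoal for x by (cases x) (auto simp: Qm_def)
  done

lemma mut_Q0:
  assumes "M \<ge> 4"
  shows "nmut (T 0) (Q0 M) = Q1 M" "no_2cycles (Q1 M)"
proof -
  let ?ins = "[T 2, T (M+1), F5, F6]"
  let ?outs = "[C 2]"
  note [simp] = Q0_def Q1_def
  have row: "Q1 M (T 0) y = count_list ?ins y"
    "Q1 M y (T 0) = count_list ?outs y" for y
    using assms by (cases y; auto)+
  have io: "\<forall>x\<in>set ?ins. \<forall>y\<in>set ?outs.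
    Q1 M x y + Q0 M y x = Q0 M x y + count_list ?ins x * count_list ?outs y + Q1 M y x
    \<and> (Q1 M x y = 0 \<or> Q1 M y x = 0)"
    using assms by simp
  have other: "Q1 M x y = Q0 M x y"
    if "x \<noteq> T 0" "y \<noteq> T 0"
      "x \<in> set ?ins \<longrightarrow> y \<notin> set ?outs"
      "y \<in> set ?ins \<longrightarrow> x \<notin> set ?outs" for x y
    using assms that by (cases x; cases y) auto
  show "nmut (T 0) (Q0 M) = Q1 M"
    by (rule nmut_eqI(1)[OF rowcol_Q0[OF assms] no_2cycles_Q0[OF assms] row io]) (erule (3) other)
  show "no_2cycles (Q1 M)"
    by (rule nmut_eqI(2)[OF rowcol_Q0[OF assms] no_2cycles_Q0[OF assms] row io]) (erule (3) other)
qed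

text \<open>The hypotheses exclude the pairs joined by a path through \<open>C 2\<close>. Arrows
  between t-nodes at which the two quivers differ have an end of index 0 or 1, which motivates the
  case split.\<close>

lemma cell_Q1_TT:
  assumes "M \<ge> 4" "i\<in>{2,3,M+1,M+2} \<longrightarrow> j\<notin>{0,1}" "j\<in>{2,3,M+1,M+2} \<longrightarrow> i\<notin>{0,1::nat}"
  shows "Q1 M (T i) (T j) = Qm M 2 (T i) (T j)"
proof -
  consider "i = 0" | "i = 1" | "j = 0" | "j = 1" | "i \<ge> 2" "j \<ge> 2" by linarith
  then show ?thesis using assms by cases (auto simp: Q1_def Qm_def TT_def)
qed

lemma cell_Q1_CT:
  assumes "M \<ge> 4" "j\<in>{2,3,M+1,M+2} \<longrightarrow> i\<notin>{3}" "i\<noteq>2"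
  shows "Q1 M (C i) (T j) = Qm M 2 (C i) (T j)"
proof -
  consider "i = 3" | "i \<noteq> 3" by linarith
  then show ?thesis using assms by cases (auto simp: Q1_def Qm_def TT_def)
qed

lemma cell_Q1_TC:
  assumes "M \<ge> 4" "j\<in>{2,3,M+1,M+2} \<longrightarrow> i\<notin>{3}" "i\<noteq>2"
  shows "Q1 M (T j) (C i) = Qm M 2 (T j) (C i)"
proof -
  consider "i = 3" | "i \<noteq> 3" by linarith
  then show ?thesis using assms by cases (auto simp: Q1_def Qm_def TT_def)
qed

lemma Qm_CC_cell: "i \<noteq> 2 \<Longrightarrow> j \<noteq> 2 \<Longrightarrow> Qm M 2 (C i) (C j) = Q1 M (C i) (C j)"
  by (auto simp: Qm_def Q1_def)

text \<open>From \<open>C 3\<close> on, a mutated c-node sends arrows only to c-nodes,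
  \<open>R\<close> and \<open>S\<close>, so no path through it joins two t-nodes.\<close>

lemma Qm_TT_cell: "Qm M (Suc m) (T i) (T j) = Qm M m (T i) (T j)"
  by (simp add: Qm_def)

lemma mut_Q1:
  assumes "M \<ge> 4"
  shows "nmut (C 2) (Q1 M) = Qm M 2" "no_2cycles (Qm M 2)"
proof -
  let ?ins = "[T 2, T 3, T (M+1), T (M+2), F5, F6]"
  let ?outs = "[T 0, T 1, C 3]"
  have row: "Qm M 2 (C 2) y = count_list ?ins y"
    "Qm M 2 y (C 2) = count_list ?outs y" for y
    using assms by (cases y; auto simp: Q1_def Qm_def TT_def)+
  have io: "\<forall>x\<in>set ?ins. \<forall>y\<in>set ?outs.
    Qm M 2 x y + Q1 M y x = Q1 M x y + count_list ?ins x * count_list ?outs y + Qm M 2 y x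
    \<and> (Qm M 2 x y = 0 \<or> Qm M 2 y x = 0)"
    using assms by (simp add: Q1_def Qm_def TT_def)
  have other: "Qm M 2 x y = Q1 M x y"
    if "x \<noteq> C 2" "y \<noteq> C 2"
      "x \<in> set ?ins \<longrightarrow> y \<notin> set ?outs"
      "y \<in> set ?ins \<longrightarrow> x \<notin> set ?outs" for x y
  proof -
    consider (TT) i j where "x = T i" "y = T j"
      | (CT) i j where "x = C i" "y = T j"
      | (TC) i j where "x = T i" "y = C j"
      | (CC) i j where "x = C i" "y = C j"
      | (rest) "\<not> ((\<exists>i. x = T i \<or> x = C i) \<and> (\<exists>j. y = T j \<or> y = C j))"
      by blast
    then show ?thesis
    proof cases
      case TT
      then show ?thesis using that assms cell_Q1_TT[of M i j] by simp
    next
      case CT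
      then show ?thesis using that assms cell_Q1_CT[of M j i] by simp
    next
      case TC
      then show ?thesis using that assms cell_Q1_TC[of M i j] by simp
    next
      case CC
      then show ?thesis using that assms Qm_CC_cell[of i j M] by simp
    next
      case rest
      then show ?thesis using assms that by (cases x; cases y) (simp_all add: Q1_def Qm_def)
    qed
  qed
  show "nmut (C 2) (Q1 M) = Qm M 2"
    by (rule nmut_eqI(1)[OF rowcol_Q1[OF assms] mut_Q0(2)[OF assms] row io]) (erule (3) other)
  show "no_2cycles (Qm M 2)"
    by (rule nmut_eqI(2)[OF rowcol_Q1[OF assms] mut_Q0(2)[OF assms] row io]) (erule (3) other)
qed

lemma cell_Qm_CT:
  assumes "2 \<le> m" "Suc m < M" "j\<in>{Suc m,m+2,M+1,M+2} \<longrightarrow> i\<notin>{m,m+2}" "i\<noteq>Suc m"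
  shows "Qm M m (C i) (T j) = Qm M (Suc m) (C i) (T j)"
proof -
  consider "i = m" | "i = m+2" | "i \<notin> {m,m+1,m+2}" using assms by auto
  then show ?thesis using assms by cases (auto simp: Qm_def TT_def)
qed

lemma cell_Qm_TC:
  assumes "2 \<le> m" "Suc m < M" "j\<in>{Suc m,m+2,M+1,M+2} \<longrightarrow> i\<notin>{m,m+2}" "i\<noteq>Suc m"
  shows "Qm M m (T j) (C i) = Qm M (Suc m) (T j) (C i)"
proof -
  consider "i = m" | "i = m+2" | "i \<notin> {m,m+1,m+2}" using assms by auto
  then show ?thesis using assms by cases (auto simp: Qm_def TT_def)
qed

lemma cell_Qm_CC:
  assumes "2 \<le> m" "Suc m < M"  "i\<noteq>Suc m"  "j\<noteq>Suc m"
  shows "Qm M m (C j) (C i) = Qm M (Suc m) (C j) (C i)"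
  using assms by (auto simp: Qm_def TT_def)

text \<open>Paths back to \<open>C m\<close> cancel its surplus arrows to \<open>T (Suc m)\<close>,
  \<open>T (M+1)\<close>, \<open>T (M+2)\<close>, \<open>F5\<close> and \<open>F6\<close>; paths to
  \<open>C (m+2)\<close> give that node the same far neighbours. The front thus reappears one place
  further on.\<close>

lemma mut_Qm:
  assumes "2 \<le> m" "Suc m < M" "no_2cycles (Qm M m)"
  shows "nmut (C (Suc m)) (Qm M m) = Qm M (Suc m)" "no_2cycles (Qm M (Suc m))"
proof -
  let ?ins = "[T (Suc m), T (m+2), T (M+1), T (M+2), F5, F6]"
  let ?outs = "[C m, C (m+2)]"
  have row: "Qm M (Suc m) (C (Suc m)) y = count_list ?ins y"
    "Qm M (Suc m) y (C (Suc m)) = count_list ?outs y" for y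
    using assms by (cases y; auto simp: Qm_def TT_def)+
  have io: "\<forall>x\<in>set ?ins. \<forall>y\<in>set ?outs.
    Qm M (Suc m) x y + Qm M m y x = Qm M m x y + count_list ?ins x * count_list ?outs y + Qm M (Suc m) y x
    \<and> (Qm M (Suc m) x y = 0 \<or> Qm M (Suc m) y x = 0)"
    using assms by (simp add: Qm_def TT_def)
  have other: "Qm M (Suc m) x y = Qm M m x y"
    if "x \<noteq> C (Suc m)" "y \<noteq> C (Suc m)"
      "x \<in> set ?ins \<longrightarrow> y \<notin> set ?outs"
      "y \<in> set ?ins \<longrightarrow> x \<notin> set ?outs" for x y
  proof -
    consider (TT) i j where "x = T i" "y = T j"
      | (CT) i j where "x = C i" "y = T j"
      | (TC) i j where "x = T i" "y = C j"
      | (CC) i j where "x = C i" "y = C j"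
      | (rest) "\<not> ((\<exists>i. x = T i \<or> x = C i) \<and> (\<exists>j. y = T j \<or> y = C j))"
      by blast
    then show ?thesis
    proof cases
      case TT
      then show ?thesis using that assms Qm_TT_cell[of M m i j] by simp
    next
      case CT
      then show ?thesis using that assms cell_Qm_CT[of m M j i] by simp
    next
      case TC
      then show ?thesis using that assms cell_Qm_TC[of m M i j] by simp
    next
      case CC
      then show ?thesis using that assms cell_Qm_CC[of m M j i] by simp
    next
      case rest
      then show ?thesis using assms that by (cases x; cases y) (simp_all add: Qm_def)
    qed
  qed
  show "nmut (C (Suc m)) (Qm M m) = Qm M (Suc m)"
    by (rule nmut_eqI(1)[OF rowcol_Qm[OF assms(1) Suc_lessD[OF assms(2)], unfolded if_not_P[OF less_imp_neq[OF assms(2)]]] assms(3) row io]) (erule (3) other)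
  show "no_2cycles (Qm M (Suc m))"
    by (rule nmut_eqI(2)[OF rowcol_Qm[OF assms(1) Suc_lessD[OF assms(2)], unfolded if_not_P[OF less_imp_neq[OF assms(2)]]] assms(3) row io]) (erule (3) other)
qed

lemma mut_Qm_last:
  assumes "M \<ge> 4" "M = Suc m" "no_2cycles (Qm M m)"
  shows "nmut (C M) (Qm M m) = QA M" "no_2cycles (QA M)"
proof -
  let ?ins = "[T M, T (M+1), T (M+1), T (M+2), F5, F6]"
  let ?outs = "[C m, R, S]"
  note [simp] = Qm_def QA_def TT_def
  have row: "QA M (C M) y = count_list ?ins y"
    "QA M y (C M) = count_list ?outs y" for y
    using assms by (cases y; auto)+
  have io: "\<forall>x\<in>set ?ins. \<forall>y\<in>set ?outs.
    QA M x y + Qm M m y x = Qm M m x y + count_list ?ins x * count_list ?outs y + QA M y x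
    \<and> (QA M x y = 0 \<or> QA M y x = 0)"
    using assms by simp
  have other: "QA M x y = Qm M m x y"
    if "x \<noteq> C M" "y \<noteq> C M"
      "x \<in> set ?ins \<longrightarrow> y \<notin> set ?outs"
      "y \<in> set ?ins \<longrightarrow> x \<notin> set ?outs" for x y
    using assms that by (cases x; cases y) auto
  show "nmut (C M) (Qm M m) = QA M"
    by (rule nmut_eqI(1)[OF rowcol_Qm_last[OF assms(1,2)] assms(3) row io]) (erule (3) other)
  show "no_2cycles (QA M)"
    by (rule nmut_eqI(2)[OF rowcol_Qm_last[OF assms(1,2)] assms(3) row io]) (erule (3) other)
qed

text \<open>Of the double arrow from \<open>C M\<close> to \<open>T (M+1)\<close>, the mutation at
  \<open>R\<close> cancels one copy and the one at \<open>S\<close> the other. At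
  \<open>T (M+2)\<close> the first cancels the arrow from \<open>C M\<close> and the second creates
  the opposite arrow.\<close>

lemma mut_QA:
  assumes "M \<ge> 4" "no_2cycles (QA M)"
  shows "nmut R (QA M) = QB M" "no_2cycles (QB M)"
proof -
  let ?ins = "[T (M+1), T (M+2), F5]"
  let ?outs = "[C M]"
  note [simp] = QA_def QB_def TT_def
  have row: "QB M R y = count_list ?ins y"
    "QB M y R = count_list ?outs y" for y
    using assms by (cases y; auto)+
  have io: "\<forall>x\<in>set ?ins. \<forall>y\<in>set ?outs.
    QB M x y + QA M y x = QA M x y + count_list ?ins x * count_list ?outs y + QB M y x
    \<and> (QB M x y = 0 \<or> QB M y x = 0)"
    using assms by simp
  have other: "QB M x y = QA M x y"
    if "x \<noteq> R" "y \<noteq> R"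
      "x \<in> set ?ins \<longrightarrow> y \<notin> set ?outs"
      "y \<in> set ?ins \<longrightarrow> x \<notin> set ?outs" for x y
    using assms that by (cases x; cases y) auto
  show "nmut R (QA M) = QB M"
    by (rule nmut_eqI(1)[OF rowcol_QA[OF assms(1)] assms(2) row io]) (erule (3) other)
  show "no_2cycles (QB M)"
    by (rule nmut_eqI(2)[OF rowcol_QA[OF assms(1)] assms(2) row io]) (erule (3) other)
qed

lemma mut_QB:
  assumes "M \<ge> 4" "no_2cycles (QB M)"
  shows "nmut S (QB M) = QC M" "no_2cycles (QC M)"
proof -
  let ?ins = "[T (M+1), T (M+2), F6]"
  let ?outs = "[C M]"
  note [simp] = QB_def QC_def TT_def
  have row: "QC M S y = count_list ?ins y"
    "QC M y S = count_list ?outs y" for y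
    using assms by (cases y; auto)+
  have io: "\<forall>x\<in>set ?ins. \<forall>y\<in>set ?outs.
    QC M x y + QB M y x = QB M x y + count_list ?ins x * count_list ?outs y + QC M y x
    \<and> (QC M x y = 0 \<or> QC M y x = 0)"
    using assms by simp
  have other: "QC M x y = QB M x y"
    if "x \<noteq> S" "y \<noteq> S"
      "x \<in> set ?ins \<longrightarrow> y \<notin> set ?outs"
      "y \<in> set ?ins \<longrightarrow> x \<notin> set ?outs" for x y
    using assms that by (cases x; cases y) auto
  show "nmut S (QB M) = QC M"
    by (rule nmut_eqI(1)[OF rowcol_QB[OF assms(1)] assms(2) row io]) (erule (3) other)
  show "no_2cycles (QC M)"
    by (rule nmut_eqI(2)[OF rowcol_QB[OF assms(1)] assms(2) row io]) (erule (3) other)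
qed

section \<open>Relabelling by rho on symbolic nodes\<close>

fun nrho :: "nat \<Rightarrow> node \<Rightarrow> node" where
  "nrho M R = S" | "nrho M S = R"
| "nrho M (T k) = T (if k < M + 2 then Suc k else if k = M + 2 then 0 else k)"
| "nrho M x = x"

text \<open>\<open>T 0\<close> carries the newest tau after the mutations and moves to the last
  place \<open>M + 2\<close>. Since \<open>nrho\<close> fixes larger indices, where neither quiver
  has arrows, no range condition is needed; the split over both indices resolves the
  wrap-around.\<close>

lemma QC_nrho_TT:
  assumes "M \<ge> 4" shows "QC M (nrho M (T i)) (nrho M (T j)) = Q0 M (T i) (T j)"
proof -
  consider "i < M + 2" | "i = M + 2" | "i > M+2" by linarith
  then show ?thesis using assms
    by cases (cases "j < M + 2"; cases "j = M+2"; auto simp: QC_def Q0_def TT_def)+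
qed

lemma QC_nrho: "M \<ge> 4 \<Longrightarrow> QC M (nrho M x) (nrho M y) = Q0 M x y"
proof (cases "(\<exists>i j. x = T i \<and> y = T j)")
  case True
  assume "M \<ge> 4"
  with True QC_nrho_TT show ?thesis by blast
next
  case False
  assume "M \<ge> 4"
  with False show ?thesis by (cases x; cases y) (auto simp: QC_def Q0_def)
qed

section \<open>Seeds along the mutation sequence\<close>

definition lab :: "nat \<Rightarrow> nat \<Rightarrow> node" where
  "lab N i = (if i = 0 then X 0 else if i + 1 < N then C (i + N) else if i + 1 = N then R
     else if i = N then S else if i \<le> 3*N + 1 then T (i - (N + 1)) else if i \<le> 4*N then C (i - 3*N)
     else if i = 4*N + 1 then F5 else if i = 4*N + 2 then F6 else X i)"

fun nd :: "nat \<Rightarrow> node \<Rightarrow> nat" where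
  "nd N (T k) = t_node N k" | "nd N (C k) = c_node N k" | "nd N R = N - 1" | "nd N S = N"
| "nd N F5 = 4*N + 1" | "nd N F6 = 4*N + 2" | "nd N (X i) = i"

fun valid :: "nat \<Rightarrow> node \<Rightarrow> bool" where
  "valid N (T k) = (k \<le> 2*N)" | "valid N (C k) = (2 \<le> k \<and> k + 2 \<le> 2*N)" | "valid N (X i) = False"
| "valid N _ = True"

lemma lab_nd: "N \<ge> 3 \<Longrightarrow> valid N v \<Longrightarrow> lab N (nd N v) = v"
  by (cases v) (auto simp: lab_def t_node_def c_node_def)

lemma nd_lab: "N \<ge> 3 \<Longrightarrow> i \<in> {1..4*N+2} \<Longrightarrow> nd N (lab N i) = i"
  by (auto simp: lab_def t_node_def c_node_def)

lemma valid_lab: "N \<ge> 3 \<Longrightarrow> i \<in> {1..4*N+2} \<Longrightarrow> valid N (lab N i)"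
  by (auto simp: lab_def)

lemma nd_in: "N \<ge> 3 \<Longrightarrow> valid N v \<Longrightarrow> nd N v \<in> {1..4*N+2}"
  by (cases v) (auto simp: t_node_def c_node_def)

lemma lab_X: "N \<ge> 3 \<Longrightarrow> i \<notin> {1..4*N+2} \<Longrightarrow> lab N i = X i"
  by (auto simp: lab_def)

lemma lab_inj:
  assumes "N \<ge> 3" "lab N i = lab N j" shows "i = j"
proof -
  have "nd N (lab N i) = i" for i
    using nd_lab[OF assms(1), of i] lab_X[OF assms(1), of i] by (cases "i \<in> {1..4*N+2}") auto
  then show ?thesis using assms(2) by metis
qed

lemma nd_eq_iff: "N \<ge> 3 \<Longrightarrow> valid N v \<Longrightarrow> valid N w \<Longrightarrow> nd N v = nd N w \<longleftrightarrow> v = w"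
  by (metis lab_nd)

definition pull :: "nat \<Rightarrow> (node \<Rightarrow> node \<Rightarrow> nat) \<Rightarrow> quiver" where
  "pull N q i j = q (lab N i) (lab N j)"

lemma mutate_quiver_pull:
  assumes "N \<ge> 3" "valid N v"
  shows "mutate_quiver (nd N v) (pull N q) = pull N (nmut v q)"
proof -
  \<comment> \<open>Injectivity of \<open>lab\<close> on all naturals gives this for every
    \<open>i\<close>, so the two quivers agree as functions and not merely on the nodes.\<close>
  have "i = nd N v \<longleftrightarrow> lab N i = v" for i using assms lab_inj lab_nd by metis
  then show ?thesis
    by (auto simp: mutate_quiver_def cancel_2cycles_def pull_def nmut_def fun_eq_iff lab_nd[OF assms])
qed

text \<open>Replaces a product with multiplicities over all nodes by one over a short neighbour
  list: every list entry contributes one factor, at the single label that carries it.\<close>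

lemma prod_count_list_lab:
  fixes x :: "nat \<Rightarrow> 'a::field"
  assumes "N \<ge> 3" "list_all (valid N) l"
  shows "(\<Prod>i\<in>{1..4*N+2}. x i ^ count_list l (lab N i)) = (\<Prod>v\<leftarrow>l. x (nd N v))"
  using assms(2)
proof (induction l)
  case (Cons a l)
  have "(\<Prod>i\<in>{1..4*N+2}. x i ^ count_list (a # l) (lab N i)) =
     (\<Prod>i\<in>{1..4*N+2}. (if nd N a = i then x i else 1) * x i ^ count_list l (lab N i))"
    using Cons.prems assms(1) by (intro prod.cong refl) (auto simp: lab_nd nd_lab)
  also have "\<dots> = x (nd N a) * (\<Prod>i\<in>{1..4*N+2}. x i ^ count_list l (lab N i))"
    unfolding prod.distrib using nd_in[of N a] Cons.prems assms(1) by (subst prod.delta') auto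
  finally show ?case using Cons by simp
qed simp

lemma mutate_pull:
  assumes "N \<ge> 3" "valid N v" "rowcol q v ins outs" "list_all (valid N) (ins @ outs)"
  shows "mutate {1..4*N+2} (nd N v) (pull N q, x) = (pull N (nmut v q),
     x(nd N v := ((\<Prod>v\<leftarrow>ins. x (nd N v)) + (\<Prod>v\<leftarrow>outs. x (nd N v))) / x (nd N v)))"
proof -
  have "pull N q i (nd N v) = count_list ins (lab N i)" "pull N q (nd N v) i = count_list outs (lab N i)" for i
    using assms by (auto simp: pull_def rowcol_def lab_nd)
  then show ?thesis using assms prod_count_list_lab[of N ins x]  prod_count_list_lab[of N outs x]
    by (simp add: mutate_quiver_pull)
qed

section \<open>Identification of \<open>Q0\<close> with the given quiver\<close>

lemma lab_simps:
  assumes "N \<ge> 3"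
  shows "k \<le> 2*N \<Longrightarrow> lab N (t_node N k) = T k"
    "2 \<le> k \<Longrightarrow> k \<le> 2*N - 2 \<Longrightarrow> lab N (c_node N k) = C k"
    "lab N (N - Suc 0) = R" "lab N N = S" "lab N (Suc (4*N)) = F5" "lab N (Suc (Suc (4*N))) = F6"
  using lab_nd[OF assms, of "T k"] lab_nd[OF assms, of "C k"] lab_nd[OF assms, of R] lab_nd[OF assms, of S]
    lab_nd[OF assms, of F5] lab_nd[OF assms, of F6] assms by auto

lemma Q0_lab_of_QD_arrows:
  assumes N: "N \<ge> 3" and "(i, j) \<in> QD_arrows N"
  shows "Q0 (2*N - 2) (lab N i) (lab N j) = 1"
  using assms(2) unfolding QD_arrows_def Let_def
  apply (elim UnE)
  subgoal using N by (auto simp: lab_simps Q0_def)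
  subgoal using N by (auto simp: lab_simps Q0_def)
  subgoal using N by (auto simp: lab_simps Q0_def)
  subgoal using N by (auto simp: lab_simps Q0_def)
  subgoal using N by (auto simp: lab_simps Q0_def)
  subgoal using N by (auto simp: lab_simps Q0_def)
  subgoal using N by (auto simp: lab_simps Q0_def)
  subgoal using N by (auto simp: lab_simps Q0_def)
  done

lemma QD_arrowsI0:
  "1 \<le> k \<Longrightarrow> k \<le> 2*N - 1 \<Longrightarrow> (t_node N k, t_node N (k + 1)) \<in> QD_arrows N"
  "2 \<le> k \<Longrightarrow> k \<le> 2*N - 3 \<Longrightarrow> (c_node N k, c_node N (k + 1)) \<in> QD_arrows N"
  "2 \<le> k \<Longrightarrow> k \<le> 2*N - 2 \<Longrightarrow> (c_node N k, t_node N (k - 1)) \<in> QD_arrows N"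
  "2 \<le> k \<Longrightarrow> k \<le> 2*N - 2 \<Longrightarrow> (t_node N (k + 1), c_node N k) \<in> QD_arrows N"
  unfolding QD_arrows_def Let_def
  subgoal by (rule UnI1, rule UnI1, rule UnI1, rule UnI1, rule UnI1, rule UnI1, rule UnI1) auto
  subgoal by (rule UnI1, rule UnI1, rule UnI1, rule UnI1, rule UnI1, rule UnI1, rule UnI2) auto
  subgoal by (rule UnI1, rule UnI1, rule UnI1, rule UnI1, rule UnI1, rule UnI2) auto
  subgoal by (rule UnI1, rule UnI1, rule UnI1, rule UnI1, rule UnI2) auto
  done

text \<open>Predecessors are written away with \<open>Suc\<close>, to match goals in which an
  equation such as \<open>i = j + 1\<close> from \<open>Q0\<close> has been substituted.\<close>

lemma QD_arrowsI:
  "1 \<le> k \<Longrightarrow> k \<le> 2*N - 1 \<Longrightarrow> (t_node N k, t_node N (Suc k)) \<in> QD_arrows N"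
  "2 \<le> k \<Longrightarrow> k \<le> 2*N - 3 \<Longrightarrow> (c_node N k, c_node N (Suc k)) \<in> QD_arrows N"
  "2 \<le> Suc k \<Longrightarrow> Suc k \<le> 2*N - 2 \<Longrightarrow> (c_node N (Suc k), t_node N k) \<in> QD_arrows N"
  "2 \<le> k \<Longrightarrow> k \<le> 2*N - 2 \<Longrightarrow> (t_node N (Suc k), c_node N k) \<in> QD_arrows N"
  using QD_arrowsI0[of k N] QD_arrowsI0(3)[of "Suc k" N] by simp_all

lemma QD_arrowsI':
  "(c_node N (2*N - 2), N - 1) \<in> QD_arrows N" "(c_node N (2*N - 2), N) \<in> QD_arrows N"
  "(N - 1, t_node N (2*N - 2)) \<in> QD_arrows N" "(N, t_node N (2*N - 2)) \<in> QD_arrows N"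
  "(N - 1, t_node N (2*N - 1)) \<in> QD_arrows N" "(N, t_node N (2*N - 1)) \<in> QD_arrows N"
  "(t_node N 0, c_node N 2) \<in> QD_arrows N" "(t_node N (2*N), c_node N 2) \<in> QD_arrows N"
  "(t_node N 2, t_node N 0) \<in> QD_arrows N" "(t_node N 2, t_node N (2*N)) \<in> QD_arrows N"
  "(t_node N (2*N - 1), t_node N 0) \<in> QD_arrows N" "(t_node N 1, t_node N (2*N - 1)) \<in> QD_arrows N"
  "(4*N + 1, t_node N 0) \<in> QD_arrows N" "(4*N + 2, t_node N 0) \<in> QD_arrows N"
  "(N, 4*N + 1) \<in> QD_arrows N" "(N - 1, 4*N + 2) \<in> QD_arrows N"
  unfolding QD_arrows_def Let_def by simp_all

lemma QD_arrows_of_Q0: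
  assumes N: "N \<ge> 3" and v: "valid N x" "valid N y" and Q: "Q0 (2*N - 2) x y \<noteq> 0"
  shows "(nd N x, nd N y) \<in> QD_arrows N"
proof -
  define M where "M = 2*N - 2"
  have e: "2*N - 1 = M + 1" "2*N = M + 2" "4 \<le> M" "2*N - 3 = M - 1" using N by (auto simp: M_def)
  note I = QD_arrowsI[of _ N, unfolded e(1,4) M_def[symmetric]] QD_arrowsI'[of N, unfolded M_def[symmetric] e(1), unfolded e(2)]
  show ?thesis
    using Q e(3) unfolding M_def[symmetric] by (cases x; cases y) (auto simp: Q0_def intro: I I[simplified])
qed

text \<open>The two inclusions give the value 1 on arrows and 0 elsewhere. A label outside the node
  range becomes an \<open>X\<close>, which has no arrows in \<open>Q0\<close>.\<close>

lemma QD_eq_pull: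
  assumes "N \<ge> 3" shows "QD N = pull N (Q0 (2*N - 2))"
proof (intro ext)
  fix i j
  have Q0: "Q0 M x y \<le> 1" for M x y by (cases x; cases y) (auto simp: Q0_def)
  show "QD N i j = pull N (Q0 (2*N - 2)) i j"
  proof (cases "(i, j) \<in> QD_arrows N")
    case True
    then show ?thesis using Q0_lab_of_QD_arrows[OF assms True] by (simp add: QD_def pull_def)
  next
    case False
    have "Q0 (2*N - 2) (lab N i) (lab N j) = 0"
    proof (rule ccontr)
      assume *: "Q0 (2*N - 2) (lab N i) (lab N j) \<noteq> 0"
      have "i \<in> {1..4*N+2} \<and> j \<in> {1..4*N+2}"
      proof (rule ccontr)
        assume "\<not> (i \<in> {1..4*N+2} \<and> j \<in> {1..4*N+2})"
        then have "lab N i = X i \<or> lab N j = X j" using lab_X[OF assms] by blast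
        then show False using * by (cases "lab N i"; cases "lab N j") (auto simp: Q0_def)
      qed
      with * False show False
        using QD_arrows_of_Q0[OF assms valid_lab[OF assms, of i] valid_lab[OF assms, of j]] nd_lab[OF assms] by auto
    qed
    with False show ?thesis by (simp add: QD_def pull_def)
  qed
qed

section \<open>Exchange relations along the mutation sequence\<close>

lemma psi_list:
  assumes "N \<ge> 3"
  shows "[N + 1] @ [3 * N + 2..<4 * N + 1] @ [1..<N + 1] = map (nd N) (T 0 # map C [2..<2*N-1] @ [R, S])"
proof -
  \<comment> \<open>The nodes c_2, ..., c_N have the labels 3N+2, ..., 4N and c_{N+1}, ..., c_{2N-2}
    the labels 1, ..., N-2, so the order of mutations in \<open>psi\<close> runs once along the
    chain.\<close>
  have "[3 * N + 2..<4 * N + 1] = map (c_node N) [2..<N+1]"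
    by (rule map_upt_eqI[symmetric]) (auto simp: c_node_def simp del: upt_Suc)
  moreover have "[1..<N - 1] = map (c_node N) [N+1..<2*N-1]"
    by (rule map_upt_eqI[symmetric]) (use assms in \<open>auto simp: c_node_def\<close>)
  moreover have "[1..<N+1] = [1..<N-1] @ [N-1,N]"
  proof -
    obtain n where "N = Suc (Suc (Suc n))" using assms by (metis Suc_le_D numeral_3_eq_3 Suc_le_mono)
    then show ?thesis by simp
  qed
  moreover have "[2..<2*N-1] = [2..<N+1] @ [N+1..<2*N-1]"
  proof -
    have "N + 1 + (N - 2) = 2*N - 1" "2 \<le> N + 1" using assms by auto
    then show ?thesis using upt_add_eq_append[of 2 "N+1" "N-2"] by metis
  qed
  ultimately show ?thesis by (simp add: t_node_def comp_def)
qed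

text \<open>Everything is expressed through the cluster \<open>x\<close> before the sequence: apart
  from its predecessor, which has its new value, every neighbour of a c-node is still unmutated when
  its turn comes. \<open>C 2\<close> stands apart because its predecessor \<open>T 0\<close> is
  accompanied by \<open>T 1\<close>.\<close>

definition partial_step :: "nat \<Rightarrow> (nat \<Rightarrow> 'a::field) \<Rightarrow> nat \<Rightarrow> (nat \<Rightarrow> 'a) \<Rightarrow> bool" where
  "partial_step N x m y \<longleftrightarrow> (\<forall>v. valid N v \<longrightarrow> v \<notin> {T 0} \<union> C ` {2..m} \<longrightarrow> y (nd N v) = x (nd N v))
   \<and> y (nd N (T 0)) = (x (nd N (T 2)) * x (nd N (T (2*N - 1))) * x (nd N F5) * x (nd N F6) + x (nd N (C 2))) / x (nd N (T 0))
   \<and> y (nd N (C 2)) = (x (nd N (T 2)) * x (nd N (T 3)) * x (nd N (T (2*N - 1))) * x (nd N (T (2*N))) * x (nd N F5) * x (nd N F6)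
         + y (nd N (T 0)) * x (nd N (T 1)) * x (nd N (C 3))) / x (nd N (C 2))
   \<and> (\<forall>k\<in>{3..m}. y (nd N (C k)) = (x (nd N (T k)) * x (nd N (T (k+1))) * x (nd N (T (2*N - 1))) * x (nd N (T (2*N))) * x (nd N F5) * x (nd N F6)
         + y (nd N (C (k - 1))) * (if k = 2*N - 2 then x (nd N R) * x (nd N S) else x (nd N (C (k+1))))) / x (nd N (C k)))"

lemma fold_init:
  assumes "N \<ge> 3"
  shows "\<exists>y. fold (mutate {1..4*N+2}) (map (nd N) [T 0, C 2]) (QD N, x) = (pull N (Qm (2*N-2) 2), y)
     \<and> partial_step N x 2 y"
proof -
  have M: "4 \<le> 2*N - 2" using assms by simp
  have e: "2*N - 2 + 1 = 2*N - 1" "2*N - 2 + 2 = 2*N" using assms by auto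
  note r0 = rowcol_Q0[OF M, unfolded e] and r1 = rowcol_Q1[OF M, unfolded e]
  define y1 where "y1 = x(nd N (T 0) := ((\<Prod>v\<leftarrow>[T 2, T (2*N-1), F5, F6]. x (nd N v)) + (\<Prod>v\<leftarrow>[C 2]. x (nd N v))) / x (nd N (T 0)))"
  have 1: "mutate {1..4*N+2} (nd N (T 0)) (QD N, x) = (pull N (Q1 (2*N-2)), y1)"
    unfolding QD_eq_pull[OF assms] y1_def mut_Q0(1)[OF M, symmetric]
    by (rule mutate_pull[OF assms _ r0]) (use assms in auto)
  define y2 where "y2 = y1(nd N (C 2) := ((\<Prod>v\<leftarrow>[T 2, T 3, T (2*N-1), T (2*N), F5, F6]. y1 (nd N v))
        + (\<Prod>v\<leftarrow>[T 0, T 1, C 3]. y1 (nd N v))) / y1 (nd N (C 2)))"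
  have 2: "mutate {1..4*N+2} (nd N (C 2)) (pull N (Q1 (2*N-2)), y1) = (pull N (Qm (2*N-2) 2), y2)"
    unfolding y2_def mut_Q1(1)[OF M, symmetric]
    by (rule mutate_pull[OF assms _ r1]) (use assms in auto)
  have y1: "y1 (nd N v) = x (nd N v)" if "valid N v" "v \<noteq> T 0" for v
    using that nd_eq_iff[OF assms, of v "T 0"] by (auto simp: y1_def)
  have y2: "y2 (nd N v) = y1 (nd N v)" if "valid N v" "v \<noteq> C 2" for v
    using that nd_eq_iff[OF assms, of v "C 2"] assms by (auto simp: y2_def)
  have "y1 (nd N (T 0)) = (x (nd N (T 2)) * x (nd N (T (2*N - 1))) * x (nd N F5) * x (nd N F6) + x (nd N (C 2))) / x (nd N (T 0))"
    by (simp add: y1_def ac_simps)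
  moreover have "y2 (nd N (C 2)) = (\<Prod>v\<leftarrow>[T 2, T 3, T (2*N-1), T (2*N), F5, F6]. y1 (nd N v)) / y1 (nd N (C 2))
        + (\<Prod>v\<leftarrow>[T 0, T 1, C 3]. y1 (nd N v)) / y1 (nd N (C 2))" by (simp add: y2_def add_divide_distrib)
  ultimately have "partial_step N x 2 y2"
    unfolding partial_step_def using assms
    by (simp add: y2 y1 ac_simps add_divide_distrib del: nd.simps)
  then show ?thesis using 1 2 by (intro exI[of _ y2]) simp
qed

text \<open>The conditional handles the end of the chain, where \<open>Qm\<close> gives way to
  \<open>QA\<close>. Absence of 2-cycles belongs to the induction claim because the next mutation
  lemma requires it.\<close>

lemma fold_C:
  assumes "N \<ge> 3" "2 \<le> m" "m + 2 \<le> 2*N"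
  shows "\<exists>y. fold (mutate {1..4*N+2}) (map (nd N) (T 0 # map C [2..<Suc m])) (QD N, x)
        = (pull N (if m = 2*N - 2 then QA (2*N-2) else Qm (2*N-2) m), y)
     \<and> (no_2cycles (if m = 2*N - 2 then QA (2*N-2) else Qm (2*N-2) m)) \<and> partial_step N x m y"
  using assms(2,3)
proof (induction m rule: dec_induct)
  case base
  have "4 \<le> 2*N - 2" using assms by simp
  moreover have "[2..<Suc 2] = [2]" "2 \<noteq> 2*N - 2" using assms(1) by auto
  ultimately show ?case using mut_Q1(2) fold_init[OF assms(1), of x] by (simp only: if_False list.map) blast
next
  case (step m)
  define M where "M = 2*N - 2"
  have e: "2*N - 1 = M + 1" "2*N = M + 2" "4 \<le> M" using assms(1) by (auto simp: M_def)
  from step have m: "m < M" "2 \<le> m" by (auto simp: M_def)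
  with step obtain y where y: "fold (mutate {1..4*N+2}) (map (nd N) (T 0 # map C [2..<Suc m])) (QD N, x)
        = (pull N (Qm M m), y)" "no_2cycles (Qm M m)" and ps: "partial_step N x m y"
    by (auto simp: M_def)
  let ?ins = "[T (Suc m), T (m+2), T (M+1), T (M+2), F5, F6]"
  let ?outs = "C m # (if Suc m = M then [R, S] else [C (m+2)])"
  define y' where "y' = y(nd N (C (Suc m)) := ((\<Prod>v\<leftarrow>?ins. y (nd N v)) + (\<Prod>v\<leftarrow>?outs. y (nd N v))) / y (nd N (C (Suc m))))"
  define q where "q = (if Suc m = M then QA M else Qm M (Suc m))"
  have q: "nmut (C (Suc m)) (Qm M m) = q" "no_2cycles q"
    using mut_Qm[of m M] mut_Qm_last[of M m] y(2) m e by (auto simp: q_def)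
  have "mutate {1..4*N+2} (nd N (C (Suc m))) (pull N (Qm M m), y) = (pull N q, y')"
    unfolding y'_def q(1)[symmetric]
    by (rule mutate_pull[OF assms(1) _ rowcol_Qm]) (use m e in auto)
  then have 1: "fold (mutate {1..4*N+2}) (map (nd N) (T 0 # map C [2..<Suc (Suc m)])) (QD N, x) = (pull N q, y')"
    using y(1) m by simp
  have y': "y' (nd N v) = y (nd N v)" if "valid N v" "v \<noteq> C (Suc m)" for v
    using that nd_eq_iff[OF assms(1), of v "C (Suc m)"] m e by (auto simp: y'_def)
  have y0: "y (nd N v) = x (nd N v)" if "valid N v" "v \<notin> {T 0} \<union> C ` {2..m}" for v
    using that ps by (simp add: partial_step_def)
  have "y' (nd N (C (Suc m))) = (\<Prod>v\<leftarrow>?ins. y (nd N v)) / y (nd N (C (Suc m))) + (\<Prod>v\<leftarrow>?outs. y (nd N v)) / y (nd N (C (Suc m)))"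
    by (simp add: y'_def add_divide_distrib)
  \<comment> \<open>All in-neighbours still have their old values; among the out-neighbours only
    \<open>C m\<close> has changed.\<close>
  then have new: "y' (nd N (C (Suc m))) = (x (nd N (T (Suc m))) * x (nd N (T (Suc m+1))) * x (nd N (T (2*N - 1))) * x (nd N (T (2*N))) * x (nd N F5) * x (nd N F6)
         + y' (nd N (C (Suc m - 1))) * (if Suc m = 2*N - 2 then x (nd N R) * x (nd N S) else x (nd N (C (Suc m+1))))) / x (nd N (C (Suc m)))"
    using m e by (auto simp add: y0 y' ac_simps add_divide_distrib image_iff simp del: nd.simps)
  have "partial_step N x (Suc m) y'"
    unfolding partial_step_def
  proof (intro conjI ballI allI impI)
    fix v assume "valid N v" "v \<notin> {T 0} \<union> C ` {2..Suc m}"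
    then show "y' (nd N v) = x (nd N v)" using m by (subst y') (auto intro!: y0)
  next
    fix k assume k: "k \<in> {3..Suc m}"
    show "y' (nd N (C k)) = (x (nd N (T k)) * x (nd N (T (k+1))) * x (nd N (T (2*N - 1))) * x (nd N (T (2*N))) * x (nd N F5) * x (nd N F6)
         + y' (nd N (C (k - 1))) * (if k = 2*N - 2 then x (nd N R) * x (nd N S) else x (nd N (C (k+1))))) / x (nd N (C k))"
    proof (cases "k = Suc m")
      case True show ?thesis unfolding True by (rule new)
    next
      case False
      with k m e have "valid N (C k)" "valid N (C (k-1))" "C k \<noteq> C (Suc m)" "C (k-1) \<noteq> C (Suc m)" "k \<in> {3..m}" by auto
      then show ?thesis using ps unfolding partial_step_def by (simp add: y' del: nd.simps)
    qed
  qed (use ps m e in \<open>simp_all add: partial_step_def y' del: nd.simps\<close>)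
  then show ?case using 1 q(2) unfolding q_def M_def by auto
qed

lemma lab_rho: "N \<ge> 3 \<Longrightarrow> lab N (rho N i) = nrho (2*N - 2) (lab N i)"
  by (auto simp: lab_def rho_def)

text \<open>In quotient form the step can be proved for arbitrary field values, with
  \<open>x / 0 = 0\<close>. The value at \<open>N\<close> is divided by the old one at
  \<open>N - 1\<close>, and conversely, because of the exchange in rho.\<close>

definition cluster_step :: "nat \<Rightarrow> (nat \<Rightarrow> 'a::field) \<Rightarrow> (nat \<Rightarrow> 'a) \<Rightarrow> bool" where
  "cluster_step N x x' \<longleftrightarrow> (\<forall>k<2*N. x' (t_node N k) = x (t_node N (k+1)))
   \<and> x' (t_node N (2*N)) = (x (4*N+1) * x (4*N+2) * x (t_node N (2*N - 1)) * x (t_node N 2) + x (c_node N 2)) / x (t_node N 0)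
   \<and> x' (c_node N 2) = (x (4*N+1) * x (4*N+2) * x (t_node N (2*N - 1)) * x (t_node N (2*N)) * x (t_node N 2) * x (t_node N 3)
         + x (c_node N 3) * x' (t_node N (2*N)) * x (t_node N 1)) / x (c_node N 2)
   \<and> (\<forall>k\<in>{3..2*N-3}. x' (c_node N k) = (x (4*N+1) * x (4*N+2) * x (t_node N (2*N - 1)) * x (t_node N (2*N)) * x (t_node N k) * x (t_node N (k+1))
         + x' (c_node N (k-1)) * x (c_node N (k+1))) / x (c_node N k))
   \<and> x' (c_node N (2*N-2)) = (x (4*N+1) * x (4*N+2) * (x (t_node N (2*N - 1)))\<^sup>2 * x (t_node N (2*N)) * x (t_node N (2*N-2))
         + x' (c_node N (2*N-3)) * x (N - 1) * x N) / x (c_node N (2*N-2))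
   \<and> x' N = (x (4*N+1) * x (t_node N (2*N-1)) * x (t_node N (2*N)) + x' (c_node N (2*N-2))) / x (N - 1)
   \<and> x' (N - 1) = (x (4*N+2) * x (t_node N (2*N-1)) * x (t_node N (2*N)) + x' (c_node N (2*N-2))) / x N
   \<and> x' (4*N+1) = x (4*N+1) \<and> x' (4*N+2) = x (4*N+2)"

lemma psi_QD:
  assumes "N \<ge> 3"
  shows "\<exists>x'. psi N (QD N, x) = (QD N, x') \<and> cluster_step N x x'"
proof -
  define M where "M = 2*N - 2"
  have e: "2*N - 1 = M + 1" "2*N - 2 = M" "2*N - 3 = M - 1" "2*N = M + 2" "4 \<le> M" using assms(1) by (auto simp: M_def)
  obtain y where fy: "fold (mutate {1..4*N+2}) (map (nd N) (T 0 # map C [2..<2*N-1])) (QD N, x) = (pull N (QA M), y)"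
     and qa: "no_2cycles (QA M)" and ps: "partial_step N x M y"
    using fold_C[OF assms, of M x] e by auto
  have rA: "rowcol (QA M) R [T (M+1), T (M+2), F5] [C M]" and rB: "rowcol (QB M) S [T (M+1), T (M+2), F6] [C M]"
    using rowcol_QA rowcol_QB e by auto
  note mA = mut_QA[OF e(5) qa]
  note mB = mut_QB[OF e(5) mA(2)]
  define y1 where "y1 = y(nd N R := ((\<Prod>v\<leftarrow>[T (M+1), T (M+2), F5]. y (nd N v)) + (\<Prod>v\<leftarrow>[C M]. y (nd N v))) / y (nd N R))"
  define y2 where "y2 = y1(nd N S := ((\<Prod>v\<leftarrow>[T (M+1), T (M+2), F6]. y1 (nd N v)) + (\<Prod>v\<leftarrow>[C M]. y1 (nd N v))) / y1 (nd N S))"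
  have 1: "mutate {1..4*N+2} (nd N R) (pull N (QA M), y) = (pull N (QB M), y1)"
    unfolding y1_def mA(1)[symmetric]
    by (rule mutate_pull[OF assms _ rA]) (use e in auto)
  have 2: "mutate {1..4*N+2} (nd N S) (pull N (QB M), y1) = (pull N (QC M), y2)"
    unfolding y2_def mB(1)[symmetric]
    by (rule mutate_pull[OF assms _ rB]) (use e in auto)
  have "psi N (QD N, x) = relabel (rho N) (pull N (QC M), y2)"
    unfolding psi_def psi_list[OF assms] using fy 1 2 by simp
  also have "\<dots> = (QD N, y2 \<circ> rho N)"
    using QC_nrho[OF e(5)] e by (simp add: pull_def QD_eq_pull[OF assms] lab_rho[OF assms] fun_eq_iff)
  finally have psi: "psi N (QD N, x) = (QD N, y2 \<circ> rho N)" .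
  have y1: "y1 (nd N v) = y (nd N v)" if "valid N v" "v \<noteq> R" for v
    using that nd_eq_iff[OF assms(1), of v R] by (auto simp: y1_def)
  have y2: "y2 (nd N v) = y1 (nd N v)" if "valid N v" "v \<noteq> S" for v
    using that nd_eq_iff[OF assms(1), of v S] by (auto simp: y2_def)
  have y0: "y (nd N v) = x (nd N v)" if "valid N v" "v \<notin> {T 0} \<union> C ` {2..M}" for v
    using that ps by (simp add: partial_step_def)
  have rho: "rho N (t_node N k) = t_node N (k+1)" if "k < 2*N" for k
    using that assms by (auto simp: t_node_def rho_def)
  have rho': "rho N (t_node N (2*N)) = t_node N 0" "rho N (N - 1) = N" "rho N N = N - 1" "rho N (4*N+1) = 4*N+1"
     "rho N (4*N+2) = 4*N+2"
    using assms by (auto simp: t_node_def rho_def)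
  have rho'': "rho N (c_node N k) = c_node N k" if "2 \<le> k" "k \<le> 2*N-2" for k
    using that assms by (auto simp: c_node_def rho_def)
  have "y1 (nd N R) = (\<Prod>v\<leftarrow>[T (M+1), T (M+2), F5]. y (nd N v)) / y (nd N R) + y (nd N (C M)) / y (nd N R)"
    by (simp add: y1_def add_divide_distrib)
  then have R: "y2 (nd N R) = (x (nd N F5) * x (nd N (T (M+1))) * x (nd N (T (M+2))) + y2 (nd N (C M))) / x (nd N R)"
    using e by (simp add: y2 y1 y0 image_iff add_divide_distrib ac_simps del: nd.simps)
  have "y2 (nd N S) = (\<Prod>v\<leftarrow>[T (M+1), T (M+2), F6]. y1 (nd N v)) / y1 (nd N S) + y1 (nd N (C M)) / y1 (nd N S)"
    by (simp add: y2_def add_divide_distrib)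
  then have S: "y2 (nd N S) = (x (nd N F6) * x (nd N (T (M+1))) * x (nd N (T (M+2))) + y2 (nd N (C M))) / x (nd N S)"
    using e by (simp add: y2 y1 y0 image_iff add_divide_distrib ac_simps del: nd.simps)
  \<comment> \<open>After the c-chain only \<open>R\<close> and \<open>S\<close> are
    mutated.\<close>
  have yy: "y (nd N v) = y2 (nd N v)" if "valid N v" "v \<noteq> R" "v \<noteq> S" for v
    using that by (simp add: y1 y2)
  have T0: "y2 (nd N (T 0)) = (x (nd N (T 2)) * x (nd N (T (2*N - 1))) * x (nd N F5) * x (nd N F6) + x (nd N (C 2))) / x (nd N (T 0))"
    using ps unfolding partial_step_def by (simp add: yy del: nd.simps)
  have C2: "y2 (nd N (C 2)) = (x (nd N (T 2)) * x (nd N (T 3)) * x (nd N (T (2*N - 1))) * x (nd N (T (2*N))) * x (nd N F5) * x (nd N F6)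
         + y2 (nd N (T 0)) * x (nd N (T 1)) * x (nd N (C 3))) / x (nd N (C 2))"
    using ps e unfolding partial_step_def by (simp add: yy del: nd.simps)
  have Ck: "y2 (nd N (C k)) = (x (nd N (T k)) * x (nd N (T (k+1))) * x (nd N (T (2*N - 1))) * x (nd N (T (2*N))) * x (nd N F5) * x (nd N F6)
         + y2 (nd N (C (k - 1))) * (if k = 2*N - 2 then x (nd N R) * x (nd N S) else x (nd N (C (k+1))))) / x (nd N (C k))"
    if "k \<in> {3..M}" for k
  proof -
    have "valid N (C k)" "valid N (C (k-1))" using that e by auto
    then have "y (nd N (C k)) = y2 (nd N (C k))" "y (nd N (C (k-1))) = y2 (nd N (C (k-1)))" by (auto intro!: yy simp del: nd.simps)
    moreover note ps[unfolded partial_step_def, THEN conjunct2, THEN conjunct2, THEN conjunct2, rule_format, OF that]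
    ultimately show ?thesis by (simp only:)
  qed
  have y2x: "y2 (nd N v) = x (nd N v)" if "valid N v" "v \<notin> {T 0, R, S} \<union> C ` {2..M}" for v
    using that by (simp add: yy[symmetric] y0)
  have t: "y2 (rho N (t_node N k)) = x (t_node N (k+1))" if "k < 2*N" for k
    using y2x[of "T (k+1)"] that rho[OF that] by auto
  show ?thesis
  proof (intro exI[of _ "y2 \<circ> rho N"] conjI psi, unfold cluster_step_def, intro conjI allI impI ballI)
    fix k assume k: "k \<in> {3..2*N-3}"
    with e have "k \<in> {3..M}" "k \<noteq> M" "2 \<le> k - 1" "k - 1 \<le> 2*N - 2" "2 \<le> k" "k \<le> 2*N - 2" by auto
    then show "(y2 \<circ> rho N) (c_node N k) = (x (4*N+1) * x (4*N+2) * x (t_node N (2*N - 1)) * x (t_node N (2*N)) * x (t_node N k) * x (t_node N (k+1))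
         + (y2 \<circ> rho N) (c_node N (k-1)) * x (c_node N (k+1))) / x (c_node N k)"
      using Ck[of k] e(2) by (simp add: rho'' mult_ac)
  next
    \<comment> \<open>For k = 2N-2 the nodes t_{k+1} and t_{2N-1} coincide, whence the
      square.\<close>
    have "M \<in> {3..M}" "2 \<le> M - 1" "M - 1 \<le> M" "2 \<le> M" "M \<le> 2*N - 2" "Suc M = 2*N - 1" using e by auto
    then show "(y2 \<circ> rho N) (c_node N (2*N-2)) = (x (4*N+1) * x (4*N+2) * (x (t_node N (2*N - 1)))\<^sup>2 * x (t_node N (2*N)) * x (t_node N (2*N-2))
         + (y2 \<circ> rho N) (c_node N (2*N-3)) * x (N - 1) * x N) / x (c_node N (2*N-2))"
      using Ck[of M] unfolding e(2)[symmetric] e(3) by (simp add: rho'' e(2) mult_ac power2_eq_square)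
  next
    show "(y2 \<circ> rho N) (t_node N (2*N)) = (x (4*N+1) * x (4*N+2) * x (t_node N (2*N - 1)) * x (t_node N 2) + x (c_node N 2)) / x (t_node N 0)"
      unfolding comp_apply rho' using T0 by (simp add: mult_ac)
    have c2: "rho N (c_node N 2) = c_node N 2" using assms by (intro rho'') auto
    show "(y2 \<circ> rho N) (c_node N 2) = (x (4*N+1) * x (4*N+2) * x (t_node N (2*N - 1)) * x (t_node N (2*N)) * x (t_node N 2) * x (t_node N 3)
         + x (c_node N 3) * (y2 \<circ> rho N) (t_node N (2*N)) * x (t_node N 1)) / x (c_node N 2)"
      unfolding comp_apply rho' c2 using C2 by (simp add: mult_ac)
    have cM: "rho N (c_node N (2*N-2)) = c_node N (2*N-2)" using assms by (intro rho'') auto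
    show "(y2 \<circ> rho N) N = (x (4*N+1) * x (t_node N (2*N-1)) * x (t_node N (2*N)) + (y2 \<circ> rho N) (c_node N (2*N-2))) / x (N - 1)"
      unfolding comp_apply rho' cM using R[folded e(1) e(4), folded e(2)] by simp
    show "(y2 \<circ> rho N) (N - 1) = (x (4*N+2) * x (t_node N (2*N-1)) * x (t_node N (2*N)) + (y2 \<circ> rho N) (c_node N (2*N-2))) / x N"
      unfolding comp_apply rho' cM using S[folded e(1) e(4), folded e(2)] by simp
    show "(y2 \<circ> rho N) (4*N+1) = x (4*N+1)" "(y2 \<circ> rho N) (4*N+2) = x (4*N+2)"
      unfolding comp_apply rho' using y2x[of F5] y2x[of F6] by auto
  qed (use t in simp)
qed

section \<open>The deformed type D map\<close>

text \<open>A mutation that creates no arrows reverses an arrow once for each mutated end. After the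
  nodes 1, ..., m, the arrows with exactly one end among them are reversed, while those with both
  ends there are back in their original direction.\<close>

definition reoriented_up_to :: "(nat \<Rightarrow> nat \<Rightarrow> bool) \<Rightarrow> nat \<Rightarrow> quiver" where
  "reoriented_up_to E m i j = of_bool (E i j \<and> \<not> (i \<le> m \<and> m < j) \<or> E j i \<and> j \<le> m \<and> m < i)"

text \<open>As \<open>E\<close> increases, the arrows into \<open>Suc m\<close> from smaller nodes
  have already been reversed when its turn comes. Nothing enters \<open>Suc m\<close>, so no path
  passes through it.\<close>

lemma mutate_quiver_source:
  assumes "\<And>i j. E i j \<Longrightarrow> i < j"
  shows "mutate_quiver (Suc m) (reoriented_up_to E m) = reoriented_up_to E (Suc m)"
proof -
  have 1: "reoriented_up_to E m i (Suc m) = 0" for i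
    using assms[of i "Suc m"] assms[of "Suc m" i] by (auto simp: reoriented_up_to_def)
  have 2: "\<not> (E i j \<and> E j i)" for i j using assms[of i j] assms[of j i] by auto
  have 3: "reoriented_up_to E m i j = 0 \<or> reoriented_up_to E m j i = 0" for i j
    using 2[of i j] by (auto simp: reoriented_up_to_def)
  have 4: "reoriented_up_to E (Suc m) i (Suc m) = reoriented_up_to E m (Suc m) i"
       "reoriented_up_to E (Suc m) (Suc m) i = 0" for i
    using assms[of i "Suc m"] assms[of "Suc m" i] by (auto simp: reoriented_up_to_def)
  have 5: "reoriented_up_to E (Suc m) i j = reoriented_up_to E m i j" if "i \<noteq> Suc m" "j \<noteq> Suc m" for i j
    using that by (auto simp: reoriented_up_to_def le_Suc_eq less_Suc_eq)
  show ?thesis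
  proof (intro ext)
    fix i j
    show "mutate_quiver (Suc m) (reoriented_up_to E m) i j = reoriented_up_to E (Suc m) i j"
      using 3[of i j] by (auto simp: mutate_quiver_def cancel_2cycles_def 1 4 5)
  qed
qed

text \<open>At a source the product over incoming arrows is empty, which leaves \<open>a k\<close>
  as constant term. Neighbours below \<open>k\<close> have been mutated already and enter with their
  new values, those above with their old ones.\<close>

lemma fold_source_mutations:
  fixes x :: "nat \<Rightarrow> 'a::field"
  assumes E: "\<And>i j. E i j \<Longrightarrow> i < j" and "m \<le> M"
  shows "\<exists>y. fold (deformed_mutate {1..M} a d) [1..<Suc m] (reoriented_up_to E 0, x) = (reoriented_up_to E m, y)
     \<and> (\<forall>k. k \<notin> {1..m} \<longrightarrow> y k = x k)
     \<and> (\<forall>k\<in>{1..m}. y k = (a k + d k * (\<Prod>j\<in>{1..M}. (if j < k then y j else x j) ^ of_bool (E k j \<or> E j k))) / x k)"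
  using assms(2)
proof (induction m)
  case (Suc m)
  then obtain y where y: "fold (deformed_mutate {1..M} a d) [1..<Suc m] (reoriented_up_to E 0, x) = (reoriented_up_to E m, y)"
     "\<And>k. k \<notin> {1..m} \<Longrightarrow> y k = x k"
     "\<And>k. k \<in> {1..m} \<Longrightarrow> y k = (a k + d k * (\<Prod>j\<in>{1..M}. (if j < k then y j else x j) ^ of_bool (E k j \<or> E j k))) / x k"
    by auto
  have 1: "reoriented_up_to E m i (Suc m) = 0" for i
    using E[of i "Suc m"] E[of "Suc m" i] by (auto simp: reoriented_up_to_def)
  have 2: "reoriented_up_to E m (Suc m) j = of_bool (E (Suc m) j \<or> E j (Suc m))" for j
    using E[of j "Suc m"] E[of "Suc m" j] by (auto simp: reoriented_up_to_def)
  define y' where "y' = y(Suc m := (a (Suc m) + d (Suc m) * (\<Prod>j\<in>{1..M}. y j ^ of_bool (E (Suc m) j \<or> E j (Suc m)))) / y (Suc m))"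
  have "deformed_mutate {1..M} a d (Suc m) (reoriented_up_to E m, y) = (reoriented_up_to E (Suc m), y')"
    by (simp add: mutate_quiver_source[OF E] y'_def 1 2)
  with y(1) have "fold (deformed_mutate {1..M} a d) [1..<Suc (Suc m)] (reoriented_up_to E 0, x) = (reoriented_up_to E (Suc m), y')"
    by simp
  moreover have "y' k = x k" if "k \<notin> {1..Suc m}" for k using that y(2)[of k] by (auto simp: y'_def)
  moreover have "y' k = (a k + d k * (\<Prod>j\<in>{1..M}. (if j < k then y' j else x j) ^ of_bool (E k j \<or> E j k))) / x k"
    if "k \<in> {1..Suc m}" for k
  proof (cases "k = Suc m")
    case True
    have "(if j < k then y' j else x j) = y j" if "j \<in> {1..M}" for j
      using True that y(2)[of j] by (auto simp: y'_def)
    with y(2)[of k] True show ?thesis by (simp add: y'_def)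
  next
    case False
    then have "k \<in> {1..m}" using that by auto
    moreover have "(if j < k then y' j else x j) = (if j < k then y j else x j)" for j
      using \<open>k \<in> {1..m}\<close> by (auto simp: y'_def)
    ultimately show ?thesis using y(3)[of k] by (simp add: y'_def)
  qed
  ultimately show ?case by blast
qed auto

lemma prod_power_of_bool:
  fixes f :: "nat \<Rightarrow> 'a::field"
  assumes "finite A" shows "(\<Prod>j\<in>A. f j ^ of_bool (P j)) = prod f {j\<in>A. P j}"
proof -
  have "f j ^ of_bool (P j) = (if P j then f j else 1)" for j by simp
  then show ?thesis using assms by (simp add: prod.inter_filter)
qed

lemma D_relations_deformed_D_map:
  fixes x :: "nat \<Rightarrow> 'a::field"
  assumes N: "N \<ge> 3" and x: "\<forall>k\<in>{1..2*N}. x k \<noteq> 0"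
  shows "D_relations N b5 b6 x (deformed_D_map (2*N) (D_params N b5 b6) (\<lambda>_. 1) x)"
proof -
  \<comment> \<open>As 2N is at least 6, the indices 2N-3, ..., 2N become n+3, ..., n+6, free of
    truncated subtraction.\<close>
  define n where "n = 2*N - 6"
  have n: "2*N = n + 6" using N by (auto simp: n_def)
  define E where "E i j \<longleftrightarrow> (1 \<le> i \<and> i \<le> n + 4 \<and> j = i + 1) \<or> (i = n + 4 \<and> j = n + 6)" for i j
  have E: "E i j \<Longrightarrow> i < j" for i j by (auto simp: E_def)
  have D0: "D_quiver (n + 6) = reoriented_up_to E 0"
    by (auto simp: D_quiver_def reoriented_up_to_def fun_eq_iff E_def)
  define y where "y = deformed_D_map (n + 6) (D_params N b5 b6) (\<lambda>_. 1) x"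
  have y: "y k = (D_params N b5 b6 k + (\<Prod>j\<in>{1..n+6}. (if j < k then y j else x j) ^ of_bool (E k j \<or> E j k))) / x k"
    if "k \<in> {1..n+6}" for k
  proof -
    obtain z where "fold (deformed_mutate {1..n+6} (D_params N b5 b6) (\<lambda>_. 1)) [1..<Suc (n+6)] (reoriented_up_to E 0, x) = (reoriented_up_to E (n+6), z)"
      and z: "\<forall>k\<in>{1..n+6}. z k = (D_params N b5 b6 k + 1 * (\<Prod>j\<in>{1..n+6}. (if j < k then z j else x j) ^ of_bool (E k j \<or> E j k))) / x k"
      using fold_source_mutations[of E "n+6" "n+6" "D_params N b5 b6" "\<lambda>_. 1" x, OF E] by blast
    then have "y = z" unfolding y_def deformed_D_map_def D0 by (simp only: Suc_eq_plus1 snd_conv)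
    with z that show ?thesis by (simp only: mult_1)
  qed
  \<comment> \<open>The neighbour set \<open>B\<close> is a parameter, so that each relation below
    follows by naming the neighbours of one node of the diagram.\<close>
  have nb: "y k * x k = D_params N b5 b6 k + (\<Prod>j\<in>B. if j < k then y j else x j)"
    if "k \<in> {1..n+6}" "{j\<in>{1..n+6}. E k j \<or> E j k} = B" for k B
  proof -
    have "x k \<noteq> 0" using x that n by auto
    then show ?thesis
      using y[OF that(1), unfolded nonzero_eq_divide_eq[OF \<open>x k \<noteq> 0\<close>]
        prod_power_of_bool[OF finite_atLeastAtMost] that(2)] by simp
  qed
  have "y 1 * x 1 = b5 * b6 + x 2"
    by (subst nb[of 1 "{2}"]) (use n in \<open>auto simp: E_def D_params_def\<close>)
  moreover have "y k * x k = b5 * b6 + x (k + 1) * y (k - 1)" if "2 \<le> k" "k \<le> n + 3" for k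
    by (subst nb[of k "{k-1,k+1}"]) (use that n in \<open>auto simp: E_def D_params_def\<close>)
  moreover have "y (n+4) * x (n+4) = b5 * b6 + x (n+5) * x (n+6) * y (n+3)"
    by (subst nb[of "n+4" "{n+3,n+5,n+6}"]) (use n in \<open>auto simp: E_def D_params_def\<close>)
  moreover have "y (n+5) * x (n+5) = b5 + y (n+4)"
    by (subst nb[of "n+5" "{n+4}"]) (use n in \<open>auto simp: E_def D_params_def\<close>)
  moreover have "y (n+6) * x (n+6) = b6 + y (n+4)"
    by (subst nb[of "n+6" "{n+4}"]) (use n in \<open>auto simp: E_def D_params_def\<close>)
  moreover have "n + 6 - 3 = n + 3" "n + 6 - 2 = n + 4" "n + 6 - 1 = n + 5" by auto
  ultimately show ?thesis unfolding D_relations_def n y_def[symmetric] by (simp only:) blast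
qed

text \<open>The system is triangular: once the earlier relations are solved, the next one has a
  single unknown, with nonzero coefficient \<open>x k\<close>.\<close>

lemma D_relations_unique:
  fixes x :: "nat \<Rightarrow> 'a::field"
  assumes N: "N \<ge> 3" and x: "\<forall>k\<in>{1..2*N}. x k \<noteq> 0"
    and "D_relations N b5 b6 x x'" "D_relations N b5 b6 x x''" "k \<in> {1..2*N}"
  shows "x' k = x'' k"
proof -
  define n where "n = 2*N - 6"
  have n: "2*N = n + 6" using N by (auto simp: n_def)
  have "n + 6 - 3 = n + 3" "n + 6 - 2 = n + 4" "n + 6 - 1 = n + 5" by auto
  note r = assms(3,4)[unfolded D_relations_def n, unfolded this]
  have c: "x' k = x'' k" if "x' k * x k = u" "x'' k * x k = u" "k \<in> {1..n+6}" for k u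
    using that x n by (metis mult_cancel_right)
  have *: "1 \<le> k \<Longrightarrow> k \<le> n + 3 \<Longrightarrow> x' k = x'' k" for k
  proof (induction k rule: dec_induct)
    case base
    show ?case by (rule c[of 1]) (use r in auto)
  next
    case (step k)
    then have "x' k = x'' k" by simp
    with step show ?case using r by (intro c[of "Suc k" "b5 * b6 + x (Suc k + 1) * x' k"]) auto
  qed
  have 4: "x' (n+4) = x'' (n+4)"
    by (rule c[of _ "b5 * b6 + x (n+5) * x (n+6) * x' (n+3)"]) (use r *[of "n+3"] in simp_all)
  have 5: "x' (n+5) = x'' (n+5)"
    by (rule c[of _ "b5 + x' (n+4)"]) (use r 4 in auto)
  have 6: "x' (n+6) = x'' (n+6)"
    by (rule c[of _ "b6 + x' (n+4)"]) (use r 4 in auto)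
  have "1 \<le> k \<and> k \<le> n + 3 \<or> k = n+4 \<or> k = n+5 \<or> k = n+6" using assms(5) n by auto
  then show ?thesis using * 4 5 6 by auto
qed

lemma D_relations_cong:
  assumes "N \<ge> 3" "\<And>k. k \<in> {1..2*N} \<Longrightarrow> x' k = x'' k"
  shows "D_relations N b5 b6 x x' \<longleftrightarrow> D_relations N b5 b6 x x''"
proof -
  have "1 \<in> {1..2*N}" "2*N-3 \<in> {1..2*N}" "2*N-2 \<in> {1..2*N}" "2*N-1 \<in> {1..2*N}" "2*N \<in> {1..2*N}"
    "\<And>k. 2 \<le> k \<Longrightarrow> k \<le> 2*N-3 \<Longrightarrow> k \<in> {1..2*N} \<and> k - 1 \<in> {1..2*N}"
    using assms(1) by auto
  then show ?thesis unfolding D_relations_def using assms(2) by (metis (no_types, lifting))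
qed

lemma D_relations_iff_deformed_D_map:
  fixes x :: "nat \<Rightarrow> 'a::field"
  assumes N: "N \<ge> 3" and x: "\<forall>k\<in>{1..2*N}. x k \<noteq> 0"
  shows "D_relations N b5 b6 x x' \<longleftrightarrow>
    (\<forall>k\<in>{1..2*N}. x' k = deformed_D_map (2*N) (D_params N b5 b6) (\<lambda>_. 1) x k)"
  using D_relations_deformed_D_map[OF assms] D_relations_unique[OF assms] D_relations_cong[OF N, of x'] by metis

section \<open>Change of variables between the tau-recursion and the x-system\<close>

lemma tau_recursion_iff_D_relations:
  fixes \<tau> :: "nat \<Rightarrow> 'a::field"
  assumes N: "N \<ge> 3" and \<tau>: "\<And>n. \<tau> n \<noteq> 0"
  shows "tau_recursion N b5 b6 \<tau> w r s \<longleftrightarrow>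
    (\<forall>n. D_relations N b5 b6 (x_of N \<tau> w r s n) (swap_last N (x_of N \<tau> w r s (n + 1))))"
  unfolding tau_recursion_def
proof (intro arg_cong[of _ _ All] ext)
  fix n
  define m where "m = 2*N - 6"
  have m: "2*N = m + 6" using N by (auto simp: m_def)
  let ?x = "x_of N \<tau> w r s n" and ?x' = "swap_last N (x_of N \<tau> w r s (n + 1))"
  have sw: "?x' k = x_of N \<tau> w r s (n + 1) k" if "k \<le> m + 4" for k
    using that m by (auto simp: swap_last_def transpose_def)
  have idx: "n + 2*N = n+m+6" "n + 2*N - Suc 0 = n+m+5" "Suc (n + 2*N) = n+m+7" "2*N - Suc 0 = m + 5" "2*N - 2 = m + 4"
    using m by auto
  have x1: "?x 1 = \<tau> (n+m+6) * \<tau> n / (\<tau> (n+m+5) * \<tau> (n+1))" "?x' 1 = \<tau> (n+m+7) * \<tau> (n+1) / (\<tau> (n+m+6) * \<tau> (n+2))"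
    unfolding sw[of 1, OF order.trans[OF one_le_numeral le_add2]] by (simp_all add: x_of_def idx add_ac)
  have xk: "?x k = w k n / (\<tau> (n+m+5) * \<tau> (n+k))" "?x' k = w k (n+1) / (\<tau> (n+m+6) * \<tau> (n+k+1))"
    if "2 \<le> k" "k \<le> m + 4" for k
    unfolding sw[OF that(2)] using that by (simp_all add: x_of_def idx add_ac)
  have xl: "?x (m+5) = r n / \<tau> (n+m+5)" "?x (m+6) = s n / \<tau> (n+m+5)"
    by (simp_all add: x_of_def idx add_ac)
  \<comment> \<open>The recursion pairs r_n with s_{n+1}; the swap places both in coordinate
    2N-1.\<close>
  have sw': "?x' (m+5) = s (n+1) / \<tau> (n+m+6)" "?x' (m+6) = r (n+1) / \<tau> (n+m+6)"
    by (simp_all add: swap_last_def transpose_def x_of_def idx m add_ac)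
  have x2: "?x 2 = w 2 n / (\<tau> (n+m+5) * \<tau> (n+2))" "?x' 2 = w 2 (n+1) / (\<tau> (n+m+6) * \<tau> (n+3))"
     "?x 3 = w 3 n / (\<tau> (n+m+5) * \<tau> (n+3))"
    using xk[of 2] xk[of 3] by (simp_all add: eval_nat_numeral)
  have xm: "?x (m+4) = w (m+4) n / (\<tau> (n+m+5) * \<tau> (n+m+4))" "?x' (m+4) = w (m+4) (n+1) / (\<tau> (n+m+6) * \<tau> (n+m+5))"
     "?x' (m+3) = w (m+3) (n+1) / (\<tau> (n+m+6) * \<tau> (n+m+4))"
    using xk[of "m+4"] xk[of "m+3"] by (simp_all add: eval_nat_numeral)
  \<comment> \<open>The systems correspond equation by equation, up to a nonzero product of tau
    values: here tau_{n+2N-1} tau_{n+2}.\<close>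
  have e1: "?x' 1 * ?x 1 = b5 * b6 + ?x 2 \<longleftrightarrow>
     \<tau> (n+m+7) * \<tau> n = b5 * b6 * \<tau> (n+m+5) * \<tau> (n+2) + w 2 n"
    unfolding x1 x2 using \<tau> by (simp add: field_simps)
  \<comment> \<open>With tau_{n+2N} tau_n in the role of w_{1,n}, this is the pattern of the general
    k; it is separate because w_1 is not a variable of the recursion.\<close>
  have e2: "?x' 2 * ?x 2 = b5 * b6 + ?x 3 * ?x' 1 \<longleftrightarrow>
     w 2 (n + 1) * w 2 n = b5 * b6 * \<tau> (n+m+5) * \<tau> (n+m+6) * \<tau> (n + 2) * \<tau> (n + 3)
         + w 3 n * \<tau> (n+m+7) * \<tau> (n + 1)"
    unfolding x1 x2 using \<tau> by (simp add: field_simps)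
  have ek: "?x' k * ?x k = b5 * b6 + ?x (k+1) * ?x' (k-1) \<longleftrightarrow>
     w k (n + 1) * w k n = b5 * b6 * \<tau> (n+m+5) * \<tau> (n+m+6) * \<tau> (n + k) * \<tau> (n + k + 1)
         + w (k-1) (n+1) * w (k+1) n" if "3 \<le> k" "k \<le> m + 3" for k
  proof -
    have *: "?x (k+1) = w (k+1) n / (\<tau> (n+m+5) * \<tau> (n+k+1))" "?x' (k-1) = w (k-1) (n+1) / (\<tau> (n+m+6) * \<tau> (n+k))"
      using that xk(1)[of "k+1"] xk(2)[of "k-1"] by auto
    have **: "?x k = w k n / (\<tau> (n+m+5) * \<tau> (n+k))" "?x' k = w k (n+1) / (\<tau> (n+m+6) * \<tau> (n+k+1))"
      using that xk[of k] by auto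
    show ?thesis unfolding * ** using \<tau> by (simp add: field_simps)
  qed
  have e4: "?x' (m+4) * ?x (m+4) = b5 * b6 + ?x (m+5) * ?x (m+6) * ?x' (m+3) \<longleftrightarrow>
     w (m+4) (n + 1) * w (m+4) n = b5 * b6 * (\<tau> (n+m+5))\<^sup>2 * \<tau> (n+m+6) * \<tau> (n+m+4)
         + w (m+3) (n+1) * r n * s n"
    unfolding xm xl using \<tau> by (simp add: field_simps power2_eq_square)
  have e5: "?x' (m+5) * ?x (m+5) = b5 + ?x' (m+4) \<longleftrightarrow>
     s (n+1) * r n = b5 * \<tau> (n+m+5) * \<tau> (n+m+6) + w (m+4) (n+1)"
    unfolding xm xl sw' using \<tau> by (simp add: field_simps)
  have e6: "?x' (m+6) * ?x (m+6) = b6 + ?x' (m+4) \<longleftrightarrow>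
     r (n+1) * s n = b6 * \<tau> (n+m+5) * \<tau> (n+m+6) + w (m+4) (n+1)"
    unfolding xm xl sw' using \<tau> by (simp add: field_simps)
  have split: "(\<forall>k. 2 \<le> k \<and> k \<le> m + 3 \<longrightarrow> P k) \<longleftrightarrow> P 2 \<and> (\<forall>k. 3 \<le> k \<and> k \<le> m + 3 \<longrightarrow> P k)" for P
  proof -
    have "2 \<le> k \<longleftrightarrow> k = 2 \<or> 3 \<le> k" for k :: nat by auto
    then show ?thesis by auto
  qed
  have n': "n + m + 6 + 1 = n + m + 7" "n + m + 6 - 1 = n + m + 5" "n + (m + 6) = n + m + 6" "n + m + 6 - 2 = n + m + 4"
     "m + 6 - 3 = m + 3" "m + 6 - 2 = m + 4" "m + 6 - 1 = m + 5" "(2::nat) + 1 = 3" "(2::nat) - 1 = 1" by auto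
  show "(\<tau> (n + 2*N + 1) * \<tau> n = b5 * b6 * \<tau> (n + 2*N - 1) * \<tau> (n + 2) + w 2 n
   \<and> w 2 (n + 1) * w 2 n =
       b5 * b6 * \<tau> (n + 2*N - 1) * \<tau> (n + 2*N) * \<tau> (n + 2) * \<tau> (n + 3)
         + w 3 n * \<tau> (n + 2*N + 1) * \<tau> (n + 1)
   \<and> (\<forall>k. 3 \<le> k \<and> k \<le> 2*N - 3 \<longrightarrow>
       w k (n + 1) * w k n =
         b5 * b6 * \<tau> (n + 2*N - 1) * \<tau> (n + 2*N) * \<tau> (n + k) * \<tau> (n + k + 1)
           + w (k - 1) (n + 1) * w (k + 1) n)
   \<and> w (2*N - 2) (n + 1) * w (2*N - 2) n =
       b5 * b6 * (\<tau> (n + 2*N - 1))\<^sup>2 * \<tau> (n + 2*N) * \<tau> (n + 2*N - 2)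
         + w (2*N - 3) (n + 1) * r n * s n
   \<and> s (n + 1) * r n = b5 * \<tau> (n + 2*N - 1) * \<tau> (n + 2*N) + w (2*N - 2) (n + 1)
   \<and> r (n + 1) * s n = b6 * \<tau> (n + 2*N - 1) * \<tau> (n + 2*N) + w (2*N - 2) (n + 1))
   = D_relations N b5 b6 ?x ?x'"
    unfolding D_relations_def m n' split e1 e2 e4 e5 e6 using ek by (auto simp only:)
qed

section \<open>Subtraction-free rational functions\<close>

definition nonneg_coeffs :: "('a \<Rightarrow>\<^sub>0 'b::linordered_idom) \<Rightarrow> bool" where
  "nonneg_coeffs p \<longleftrightarrow> (\<forall>m. 0 \<le> Poly_Mapping.lookup p m)"

lemma nonneg_coeffs_add: "nonneg_coeffs p \<Longrightarrow> nonneg_coeffs q \<Longrightarrow> nonneg_coeffs (p + q)"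
  by (simp add: nonneg_coeffs_def lookup_add)

lemma nonneg_coeffs_mult:
  fixes p q :: "('a::monoid_add) \<Rightarrow>\<^sub>0 ('b::linordered_idom)"
  assumes "nonneg_coeffs p" "nonneg_coeffs q" shows "nonneg_coeffs (p * q)"
  unfolding nonneg_coeffs_def
proof
  fix m
  have "0 \<le> (\<Sum>k. Poly_Mapping.lookup q k when m = l + k)" for l
    unfolding Sum_any.expand_set using assms(2) by (intro sum_nonneg) (auto simp: nonneg_coeffs_def when_def)
  then show "0 \<le> Poly_Mapping.lookup (p * q) m"
    unfolding lookup_mult Sum_any.expand_set using assms(1) by (intro sum_nonneg) (auto simp: nonneg_coeffs_def)
qed

text \<open>Nonnegative coefficients cannot cancel: a vanishing sum forces every coefficient of both
  summands to vanish.\<close>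

lemma nonneg_coeffs_add_nonzero:
  assumes "nonneg_coeffs p" "nonneg_coeffs q" "p \<noteq> 0" shows "p + q \<noteq> 0"
proof
  assume "p + q = 0"
  then have "Poly_Mapping.lookup p m + Poly_Mapping.lookup q m = 0" for m
    by (metis lookup_add lookup_zero)
  then have "Poly_Mapping.lookup p m = 0" for m
    using assms(1,2) unfolding nonneg_coeffs_def by (metis add_nonneg_eq_0_iff)
  then show False using assms(3) by (simp add: poly_mapping_eqI)
qed

text \<open>Exchange relations use addition, multiplication and division only. This class is closed
  under all three, contains the indeterminates and omits 0.\<close>

definition subtraction_free :: "ratfun \<Rightarrow> bool" where
  "subtraction_free a \<longleftrightarrow> (\<exists>p q. a = Fract p q \<and> p \<noteq> 0 \<and> q \<noteq> 0 \<and> nonneg_coeffs p \<and> nonneg_coeffs q)"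

lemma subtraction_free_nonzero: "subtraction_free a \<Longrightarrow> a \<noteq> 0"
  by (auto simp: subtraction_free_def eq_fract Zero_fract_def)

lemma subtraction_free_add:
  assumes "subtraction_free a" "subtraction_free b" shows "subtraction_free (a + b)"
proof -
  from assms obtain p q p' q' where *: "a = Fract p q" "p \<noteq> 0" "q \<noteq> 0" "nonneg_coeffs p" "nonneg_coeffs q"
      "b = Fract p' q'" "p' \<noteq> 0" "q' \<noteq> 0" "nonneg_coeffs p'" "nonneg_coeffs q'"
    unfolding subtraction_free_def by blast
  then have "a + b = Fract (p * q' + p' * q) (q * q')" by simp
  moreover have "p * q' + p' * q \<noteq> 0" "nonneg_coeffs (p * q' + p' * q)" "nonneg_coeffs (q * q')" "q * q' \<noteq> 0"
    using * nonneg_coeffs_add_nonzero[of "p * q'" "p' * q"] by (auto intro!: nonneg_coeffs_add nonneg_coeffs_mult)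
  ultimately show ?thesis unfolding subtraction_free_def by blast
qed

lemma subtraction_free_mult:
  assumes "subtraction_free a" "subtraction_free b" shows "subtraction_free (a * b)"
proof -
  from assms obtain p q p' q' where *: "a = Fract p q" "p \<noteq> 0" "q \<noteq> 0" "nonneg_coeffs p" "nonneg_coeffs q"
      "b = Fract p' q'" "p' \<noteq> 0" "q' \<noteq> 0" "nonneg_coeffs p'" "nonneg_coeffs q'"
    unfolding subtraction_free_def by blast
  then have "a * b = Fract (p * p') (q * q')" by simp
  moreover have "p * p' \<noteq> 0" "nonneg_coeffs (p * p')" "nonneg_coeffs (q * q')" "q * q' \<noteq> 0"
    using * by (auto intro!: nonneg_coeffs_mult)
  ultimately show ?thesis unfolding subtraction_free_def by blast
qed

lemma subtraction_free_divide:
  assumes "subtraction_free a" "subtraction_free b" shows "subtraction_free (a / b)"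
proof -
  from assms(2) obtain p q where "b = Fract p q" "p \<noteq> 0" "q \<noteq> 0" "nonneg_coeffs p" "nonneg_coeffs q"
    unfolding subtraction_free_def by blast
  then have "subtraction_free (inverse b)" unfolding subtraction_free_def by (intro exI[of _ q] exI[of _ p]) simp
  then show ?thesis using subtraction_free_mult[OF assms(1)] by (simp add: divide_inverse)
qed

lemma subtraction_free_indet: "subtraction_free (indet i)"
proof -
  have "(1 :: (nat \<Rightarrow>\<^sub>0 nat) \<Rightarrow>\<^sub>0 rat) \<noteq> 0" "nonneg_coeffs (1 :: (nat \<Rightarrow>\<^sub>0 nat) \<Rightarrow>\<^sub>0 rat)"
    by (auto simp: nonneg_coeffs_def lookup_one when_def)
  moreover have "Poly_Mapping.single (Poly_Mapping.single i 1) 1 \<noteq> (0 :: (nat \<Rightarrow>\<^sub>0 nat) \<Rightarrow>\<^sub>0 rat)"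
    by (metis lookup_single_eq lookup_zero one_neq_zero)
  moreover have "nonneg_coeffs (Poly_Mapping.single (Poly_Mapping.single i 1) 1 :: (nat \<Rightarrow>\<^sub>0 nat) \<Rightarrow>\<^sub>0 rat)"
    by (auto simp: nonneg_coeffs_def lookup_single when_def)
  ultimately show ?thesis unfolding subtraction_free_def indet_def by blast
qed

section \<open>Iteration of the cluster map\<close>

text \<open>\<open>psi_QD\<close> restores the quiver and makes no assumption on the cluster, so it
  applies again at every iterate.\<close>

lemma seed_after:
  assumes "N \<ge> 3"
  shows "(psi N ^^ n) (init_seed N) = (QD N, cluster_after N n)"
    and "cluster_step N (cluster_after N n) (cluster_after N (Suc n))"
proof -
  have *: "psi N (QD N, x) = (QD N, snd (psi N (QD N, x)))" "cluster_step N x (snd (psi N (QD N, x)))"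
    for x :: "nat \<Rightarrow> ratfun"
    using psi_QD[OF assms, of x] by auto
  have 1: "(psi N ^^ n) (init_seed N) = (QD N, cluster_after N n)" for n
  proof (induction n)
    case 0 then show ?case by (simp add: init_seed_def cluster_after_def)
  next
    case (Suc n)
    then have "(psi N ^^ Suc n) (init_seed N) = psi N (QD N, cluster_after N n)" by simp
    then show ?case using *(1)[of "cluster_after N n"] unfolding cluster_after_def by (metis snd_conv)
  qed
  then show "(psi N ^^ n) (init_seed N) = (QD N, cluster_after N n)" .
  have "cluster_after N (Suc n) = snd (psi N (QD N, cluster_after N n))"
    using 1[of n] unfolding cluster_after_def by simp
  then show "cluster_step N (cluster_after N n) (cluster_after N (Suc n))"
    using *(2)[of "cluster_after N n"] by simp
qed

lemma frozen_after:
  assumes "N \<ge> 3"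
  shows "cluster_after N n (4*N + 1) = indet (4*N + 1)" "cluster_after N n (4*N + 2) = indet (4*N + 2)"
proof -
  have "cluster_after N n (4*N + 1) = indet (4*N + 1) \<and> cluster_after N n (4*N + 2) = indet (4*N + 2)"
  proof (induction n)
    case 0 then show ?case by (simp add: cluster_after_def init_seed_def)
  next
    case (Suc n) then show ?case using seed_after(2)[OF assms, of n] unfolding cluster_step_def by metis
  qed
  then show "cluster_after N n (4*N + 1) = indet (4*N + 1)" "cluster_after N n (4*N + 2) = indet (4*N + 2)" by auto
qed

definition subtraction_free_cluster :: "nat \<Rightarrow> (nat \<Rightarrow> ratfun) \<Rightarrow> bool" where
  "subtraction_free_cluster N x \<longleftrightarrow> (\<forall>k\<le>2*N. subtraction_free (x (t_node N k)))
    \<and> (\<forall>k\<in>{2..2*N-2}. subtraction_free (x (c_node N k))) \<and> subtraction_free (x (N - 1)) \<and> subtraction_free (x N)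
    \<and> subtraction_free (x (4*N+1)) \<and> subtraction_free (x (4*N+2))"

lemma subtraction_free_step:
  assumes N: "N \<ge> 3" and x: "subtraction_free_cluster N x" and s: "cluster_step N x x'"
  shows "subtraction_free_cluster N x'"
proof -
  note sf = subtraction_free_add subtraction_free_mult subtraction_free_divide
  have t: "subtraction_free (x (t_node N k))" if "k \<le> 2*N" for k
    using x that by (simp add: subtraction_free_cluster_def)
  have c: "subtraction_free (x (c_node N k))" if "2 \<le> k" "k \<le> 2*N - 2" for k
    using x that by (simp add: subtraction_free_cluster_def)
  have o: "subtraction_free (x (N - 1))" "subtraction_free (x N)" "subtraction_free (x (4*N+1))" "subtraction_free (x (4*N+2))"
    using x by (simp_all add: subtraction_free_cluster_def)
  note s = s[unfolded cluster_step_def]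
  have t': "subtraction_free (x' (t_node N k))" if "k \<le> 2*N" for k
  proof (cases "k = 2*N")
    case True
    from s have "x' (t_node N (2*N)) = (x (4*N+1) * x (4*N+2) * x (t_node N (2*N - 1)) * x (t_node N 2) + x (c_node N 2)) / x (t_node N 0)" by blast
    then show ?thesis unfolding True using N by (simp only:) (intro sf t c o; simp)
  next
    case False
    then have "k < 2*N" using that by simp
    with s have "x' (t_node N k) = x (t_node N (k+1))" by blast
    then show ?thesis using t[of "k+1"] \<open>k < 2*N\<close> by simp
  qed
  have c2: "subtraction_free (x' (c_node N 2))"
  proof -
    from s have "x' (c_node N 2) = (x (4*N+1) * x (4*N+2) * x (t_node N (2*N - 1)) * x (t_node N (2*N)) * x (t_node N 2) * x (t_node N 3)
         + x (c_node N 3) * x' (t_node N (2*N)) * x (t_node N 1)) / x (c_node N 2)" by blast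
    then show ?thesis using N by (simp only:) (intro sf t c o t'; simp)
  qed
  \<comment> \<open>The new value at the predecessor occurs in the relation, hence the induction
    along the chain.\<close>
  have ck: "2 \<le> k \<Longrightarrow> k \<le> 2*N-3 \<Longrightarrow> subtraction_free (x' (c_node N k))" for k
  proof (induction k rule: dec_induct)
    case base show ?case by (rule c2)
  next
    case (step k)
    then have "Suc k \<in> {3..2*N-3}" by auto
    with s have "x' (c_node N (Suc k)) = (x (4*N+1) * x (4*N+2) * x (t_node N (2*N - 1)) * x (t_node N (2*N)) * x (t_node N (Suc k)) * x (t_node N (Suc k+1))
         + x' (c_node N (Suc k-1)) * x (c_node N (Suc k+1))) / x (c_node N (Suc k))" by blast
    then show ?case using N step by (simp only: diff_Suc_1) (intro sf t c o; simp)
  qed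
  have cM: "subtraction_free (x' (c_node N (2*N-2)))"
  proof -
    from s have "x' (c_node N (2*N-2)) = (x (4*N+1) * x (4*N+2) * (x (t_node N (2*N - 1)))\<^sup>2 * x (t_node N (2*N)) * x (t_node N (2*N-2))
         + x' (c_node N (2*N-3)) * x (N - 1) * x N) / x (c_node N (2*N-2))" by blast
    then show ?thesis using N unfolding power2_eq_square by (simp only:) (intro sf t c o ck; simp)
  qed
  have n: "subtraction_free (x' N)"
  proof -
    from s have "x' N = (x (4*N+1) * x (t_node N (2*N-1)) * x (t_node N (2*N)) + x' (c_node N (2*N-2))) / x (N - 1)" by blast
    then show ?thesis using N by (simp only:) (intro sf t c o cM; simp)
  qed
  have n1: "subtraction_free (x' (N - 1))"
  proof -
    from s have "x' (N - 1) = (x (4*N+2) * x (t_node N (2*N-1)) * x (t_node N (2*N)) + x' (c_node N (2*N-2))) / x N" by blast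
    then show ?thesis using N by (simp only:) (intro sf t c o cM; simp)
  qed
  have "x' (4*N+1) = x (4*N+1)" "x' (4*N+2) = x (4*N+2)" using s by blast+
  moreover have "subtraction_free (x' (c_node N k))" if "k \<in> {2..2*N-2}" for k
    using that ck[of k] cM by (cases "k = 2*N-2") auto
  ultimately show ?thesis unfolding subtraction_free_cluster_def using t' n n1 o by auto
qed

lemma cluster_after_nonzero:
  assumes N: "N \<ge> 3"
  shows "k \<le> 2*N \<Longrightarrow> cluster_after N n (t_node N k) \<noteq> 0"
    "k \<in> {2..2*N-2} \<Longrightarrow> cluster_after N n (c_node N k) \<noteq> 0"
    "cluster_after N n (N - 1) \<noteq> 0" "cluster_after N n N \<noteq> 0"
proof -
  have "subtraction_free_cluster N (cluster_after N n)"
  proof (induction n)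
    case 0
    then show ?case
      by (simp add: subtraction_free_cluster_def cluster_after_def init_seed_def subtraction_free_indet)
  next
    case (Suc n)
    then show ?case using subtraction_free_step[OF N] seed_after(2)[OF N] by blast
  qed
  then show "k \<le> 2*N \<Longrightarrow> cluster_after N n (t_node N k) \<noteq> 0"
    "k \<in> {2..2*N-2} \<Longrightarrow> cluster_after N n (c_node N k) \<noteq> 0"
    "cluster_after N n (N - 1) \<noteq> 0" "cluster_after N n N \<noteq> 0"
    using subtraction_free_nonzero unfolding subtraction_free_cluster_def by blast+
qed

text \<open>Each application of \<open>psi\<close> moves the window of t-nodes by one, so the
  sequence read off at t_0 describes all 2N+1 of them.\<close>

lemma cluster_after_t_node:
  assumes "N \<ge> 3" "j \<le> 2*N"
  shows "cluster_after N n (t_node N j) = cluster_after N (n + j) (t_node N 0)"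
  using assms(2)
proof (induction j arbitrary: n)
  case (Suc j)
  have "\<forall>k<2*N. cluster_after N (Suc n) (t_node N k) = cluster_after N n (t_node N (k + 1))"
    using seed_after(2)[OF assms(1), of n] unfolding cluster_step_def by blast
  moreover have "j < 2*N" using Suc.prems by simp
  ultimately have "cluster_after N n (t_node N (Suc j)) = cluster_after N (Suc n) (t_node N j)" by simp
  also have "\<dots> = cluster_after N (Suc n + j) (t_node N 0)" using Suc by simp
  finally show ?case by simp
qed simp

definition cluster_tau :: "nat \<Rightarrow> nat \<Rightarrow> ratfun" where
  "cluster_tau N n = cluster_after N n (t_node N 0)"

definition cluster_w :: "nat \<Rightarrow> nat \<Rightarrow> nat \<Rightarrow> ratfun" where
  "cluster_w N k n = cluster_after N n (c_node N k)"

definition cluster_r :: "nat \<Rightarrow> nat \<Rightarrow> ratfun" where "cluster_r N n = cluster_after N n (N - 1)"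

definition cluster_s :: "nat \<Rightarrow> nat \<Rightarrow> ratfun" where "cluster_s N n = cluster_after N n N"

text \<open>This is \<open>cluster_step\<close> with its denominators cleared; they are nonzero
  because cluster variables are subtraction-free.\<close>

lemma tau_recursion_cluster:
  assumes N: "N \<ge> 3"
  shows "tau_recursion N (indet (4*N+1)) (indet (4*N+2)) (cluster_tau N) (cluster_w N) (cluster_r N) (cluster_s N)"
  unfolding tau_recursion_def
proof
  fix n
  have t: "cluster_after N n (t_node N j) = cluster_tau N (n + j)" if "j \<le> 2*N" for j n
    using cluster_after_t_node[OF N that] by (simp add: cluster_tau_def)
  have c: "cluster_after N n (c_node N k) = cluster_w N k n" "cluster_after N n (N - 1) = cluster_r N n"
     "cluster_after N n N = cluster_s N n" for k n by (simp_all add: cluster_w_def cluster_r_def cluster_s_def)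
  have nz: "cluster_tau N n \<noteq> 0" "cluster_r N n \<noteq> 0" "cluster_s N n \<noteq> 0"
    using cluster_after_nonzero[OF N] by (simp_all add: cluster_tau_def cluster_r_def cluster_s_def)
  have nzw: "cluster_w N k n \<noteq> 0" if "2 \<le> k" "k \<le> 2*N-2" for k
    using cluster_after_nonzero(2)[OF N, of k] that by (simp add: cluster_w_def)
  note st = seed_after(2)[OF N, of n, unfolded cluster_step_def frozen_after[OF N] c]
  have i: "n + 2*N - 1 = n + (2*N - 1)" "n + 2*N - 2 = n + (2*N - 2)" "n + 2*N + 1 = Suc n + 2*N"
    "2*N - 1 \<le> 2*N" "2*N - 2 \<le> 2*N" "0 \<le> 2*N" "1 \<le> 2*N" "2 \<le> 2*N" "3 \<le> 2*N" "2*N \<le> 2*N" "n + 0 = n" "n + 1 = Suc n"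
     using N by auto
  note st = st[unfolded t[OF i(4)] t[OF i(5)] t[OF i(6)] t[OF i(7)] t[OF i(8)] t[OF i(9)] t[OF i(10)] i(11)]
  have 1: "cluster_tau N (n + 2*N + 1) * cluster_tau N n =
     indet (4*N+1) * indet (4*N+2) * cluster_tau N (n + 2*N - 1) * cluster_tau N (n + 2) + cluster_w N 2 n"
    unfolding i using st nz by simp
  have 2: "cluster_w N 2 (n + 1) * cluster_w N 2 n =
       indet (4*N+1) * indet (4*N+2) * cluster_tau N (n + 2*N - 1) * cluster_tau N (n + 2*N) * cluster_tau N (n + 2) * cluster_tau N (n + 3)
         + cluster_w N 3 n * cluster_tau N (n + 2*N + 1) * cluster_tau N (n + 1)"
    unfolding i(1-3) using st nzw[of 2] N by simp
  have 3: "cluster_w N k (n + 1) * cluster_w N k n =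
       indet (4*N+1) * indet (4*N+2) * cluster_tau N (n + 2*N - 1) * cluster_tau N (n + 2*N) * cluster_tau N (n + k) * cluster_tau N (n + k + 1)
         + cluster_w N (k-1) (n+1) * cluster_w N (k+1) n" if k: "3 \<le> k \<and> k \<le> 2*N-3" for k
  proof -
    have "k \<in> {3..2*N-3}" using k by simp
    then have "cluster_w N k (Suc n) = (indet (4*N+1) * indet (4*N+2) * cluster_tau N (n + (2*N - 1)) * cluster_tau N (n + 2*N)
       * cluster_after N n (t_node N k) * cluster_after N n (t_node N (k+1))
         + cluster_w N (k-1) (Suc n) * cluster_w N (k+1) n) / cluster_w N k n"
      using st by blast
    moreover have "k \<le> 2*N" "k + 1 \<le> 2*N" using k by auto
    moreover have "cluster_w N k n \<noteq> 0" using k by (intro nzw) auto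
    ultimately show ?thesis unfolding i(1) by (simp add: t)
  qed
  have 4: "cluster_w N (2*N - 2) (n + 1) * cluster_w N (2*N - 2) n =
       indet (4*N+1) * indet (4*N+2) * (cluster_tau N (n + 2*N - 1))\<^sup>2 * cluster_tau N (n + 2*N) * cluster_tau N (n + 2*N - 2)
         + cluster_w N (2*N - 3) (n + 1) * cluster_r N n * cluster_s N n"
    unfolding i(1,2) using st nzw[of "2*N - 2"] N by simp
  have 5: "cluster_s N (n + 1) * cluster_r N n =
     indet (4*N+1) * cluster_tau N (n + 2*N - 1) * cluster_tau N (n + 2*N) + cluster_w N (2*N - 2) (n + 1)"
    unfolding i(1,2) using st nz by simp
  have 6: "cluster_r N (n + 1) * cluster_s N n =
     indet (4*N+2) * cluster_tau N (n + 2*N - 1) * cluster_tau N (n + 2*N) + cluster_w N (2*N - 2) (n + 1)"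
    unfolding i(1,2) using st nz by simp
  note 1 2 3 4 5 6
  then show "cluster_tau N (n + 2*N + 1) * cluster_tau N n =
     indet (4*N+1) * indet (4*N+2) * cluster_tau N (n + 2*N - 1) * cluster_tau N (n + 2) + cluster_w N 2 n
   \<and> cluster_w N 2 (n + 1) * cluster_w N 2 n =
       indet (4*N+1) * indet (4*N+2) * cluster_tau N (n + 2*N - 1) * cluster_tau N (n + 2*N) * cluster_tau N (n + 2) * cluster_tau N (n + 3)
         + cluster_w N 3 n * cluster_tau N (n + 2*N + 1) * cluster_tau N (n + 1)
   \<and> (\<forall>k. 3 \<le> k \<and> k \<le> 2*N - 3 \<longrightarrow> cluster_w N k (n + 1) * cluster_w N k n =
       indet (4*N+1) * indet (4*N+2) * cluster_tau N (n + 2*N - 1) * cluster_tau N (n + 2*N) * cluster_tau N (n + k) * cluster_tau N (n + k + 1)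
         + cluster_w N (k-1) (n+1) * cluster_w N (k+1) n)
   \<and> cluster_w N (2*N - 2) (n + 1) * cluster_w N (2*N - 2) n =
       indet (4*N+1) * indet (4*N+2) * (cluster_tau N (n + 2*N - 1))\<^sup>2 * cluster_tau N (n + 2*N) * cluster_tau N (n + 2*N - 2)
         + cluster_w N (2*N - 3) (n + 1) * cluster_r N n * cluster_s N n
   \<and> cluster_s N (n + 1) * cluster_r N n =
     indet (4*N+1) * cluster_tau N (n + 2*N - 1) * cluster_tau N (n + 2*N) + cluster_w N (2*N - 2) (n + 1)
   \<and> cluster_r N (n + 1) * cluster_s N n =
     indet (4*N+2) * cluster_tau N (n + 2*N - 1) * cluster_tau N (n + 2*N) + cluster_w N (2*N - 2) (n + 1)"
    by blast
qed

text \<open>Non-vanishing of the primed solution suffices: the divisors in a step are variables at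
  time \<open>n\<close>, on which the solutions already agree. The induction carries a window of
  2N+1 values of tau, the order of the recursion for tau.\<close>

lemma tau_recursion_unique:
  fixes \<tau> \<tau>' :: "nat \<Rightarrow> 'a::field"
  assumes N: "N \<ge> 3" and rec: "tau_recursion N b5 b6 \<tau> w r s" and rec': "tau_recursion N b5 b6 \<tau>' w' r' s'"
    and nz: "\<And>n. \<tau>' n \<noteq> 0" "\<And>k n. k \<in> {2..2*N-2} \<Longrightarrow> w' k n \<noteq> 0" "\<And>n. r' n \<noteq> 0" "\<And>n. s' n \<noteq> 0"
    and init: "\<And>j. j \<le> 2*N \<Longrightarrow> \<tau> j = \<tau>' j" "\<And>k. k \<in> {2..2*N-2} \<Longrightarrow> w k 0 = w' k 0" "r 0 = r' 0" "s 0 = s' 0"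
  shows "(\<forall>j\<le>2*N. \<tau> (n + j) = \<tau>' (n + j)) \<and> (\<forall>k\<in>{2..2*N-2}. w k n = w' k n) \<and> r n = r' n \<and> s n = s' n"
proof (induction n)
  case 0 then show ?case using init by simp
next
  case (Suc n)
  have c: "a = b" if "a * u = p" "b * u = p" "u \<noteq> 0" for a b u p :: 'a
    using that by (metis mult_cancel_right)
  note R = rec[unfolded tau_recursion_def, THEN spec, of n] and R' = rec'[unfolded tau_recursion_def, THEN spec, of n]
  note r1 = R[THEN conjunct1] and R = R[THEN conjunct2] and r1' = R'[THEN conjunct1] and R' = R'[THEN conjunct2]
  note r2 = R[THEN conjunct1] and R = R[THEN conjunct2] and r2' = R'[THEN conjunct1] and R' = R'[THEN conjunct2]
  note rk = R[THEN conjunct1] and R = R[THEN conjunct2] and rk' = R'[THEN conjunct1] and R' = R'[THEN conjunct2]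
  note r4 = R[THEN conjunct1] and R = R[THEN conjunct2] and r4' = R'[THEN conjunct1] and R' = R'[THEN conjunct2]
  note r5 = R[THEN conjunct1] and r6 = R[THEN conjunct2] and r5' = R'[THEN conjunct1] and r6' = R'[THEN conjunct2]
  have t: "\<tau> (n + j) = \<tau>' (n + j)" if "j \<le> 2*N" for j using Suc that by blast
  have w: "w k n = w' k n" if "k \<in> {2..2*N-2}" for k using Suc that by blast
  have rs: "r n = r' n" "s n = s' n" using Suc by auto
  have i: "n + 2*N - 1 = n + (2*N - 1)" "n + 2*N - 2 = n + (2*N - 2)" using N by auto
  have ts: "\<tau> n = \<tau>' n" "\<tau> (n + 1) = \<tau>' (n + 1)" "\<tau> (n + 2) = \<tau>' (n + 2)" "\<tau> (n + 3) = \<tau>' (n + 3)"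
    "\<tau> (n + 2*N) = \<tau>' (n + 2*N)" "\<tau> (n + 2*N - 1) = \<tau>' (n + 2*N - 1)" "\<tau> (n + 2*N - 2) = \<tau>' (n + 2*N - 2)"
    unfolding i using t[of 0] t[of 1] t[of 2] t[of 3] t[of "2*N"] t[of "2*N-1"] t[of "2*N-2"] N by simp_all
  have w23: "w 2 n = w' 2 n" "w 3 n = w' 3 n" "w (2*N-2) n = w' (2*N-2) n" using w N by auto
  have T: "\<tau> (n + 2*N + 1) = \<tau>' (n + 2*N + 1)"
    by (rule c[OF r1[unfolded ts w23] r1' nz(1)])
  have W2: "w 2 (n + 1) = w' 2 (n + 1)"
    by (rule c[OF r2[unfolded ts w23 T] r2' nz(2)]) (use N in auto)
  have W: "2 \<le> k \<Longrightarrow> k \<le> 2*N - 3 \<Longrightarrow> w k (n + 1) = w' k (n + 1)" for k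
  proof (induction k rule: dec_induct)
    case base show ?case by (rule W2)
  next
    case (step k)
    let ?k = "Suc k"
    have k: "3 \<le> ?k \<and> ?k \<le> 2*N - 3" using step by simp
    have "w ?k (n + 1) * w ?k n = b5 * b6 * \<tau> (n + 2*N - 1) * \<tau> (n + 2*N) * \<tau> (n + ?k) * \<tau> (n + ?k + 1)
           + w (?k - 1) (n + 1) * w (?k + 1) n" using rk k by blast
    moreover have "w' ?k (n + 1) * w' ?k n = b5 * b6 * \<tau>' (n + 2*N - 1) * \<tau>' (n + 2*N) * \<tau>' (n + ?k) * \<tau>' (n + ?k + 1)
           + w' (?k - 1) (n + 1) * w' (?k + 1) n" using rk' k by blast
    moreover have "\<tau> (n + ?k) = \<tau>' (n + ?k)" "\<tau> (n + ?k + 1) = \<tau>' (n + ?k + 1)"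
      using t[of ?k] t[of "?k+1"] k by auto
    moreover have "w (?k - 1) (n + 1) = w' (?k - 1) (n + 1)" using step by simp
    moreover have "w (?k + 1) n = w' (?k + 1) n" "w ?k n = w' ?k n" "w' ?k n \<noteq> 0" using k by (auto intro!: w nz)
    ultimately show ?case using ts by (metis mult_cancel_right)
  qed
  have W3: "w (2*N-3) (n+1) = w' (2*N-3) (n+1)" using W N by simp
  have WM: "w (2*N-2) (n + 1) = w' (2*N-2) (n + 1)"
    by (rule c[OF r4[unfolded ts w23 rs W3] r4' nz(2)]) (use N in auto)
  have "s (n+1) = s' (n+1)" by (rule c[OF r5[unfolded ts rs WM] r5' nz(3)])
  moreover have "r (n+1) = r' (n+1)" by (rule c[OF r6[unfolded ts rs WM] r6' nz(4)])
  moreover have "w k (n+1) = w' k (n+1)" if "k \<in> {2..2*N-2}" for k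
    using W[of k] WM that by (cases "k = 2*N-2") auto
  moreover have "\<tau> (Suc n + j) = \<tau>' (Suc n + j)" if "j \<le> 2*N" for j
    using t[of "Suc j"] T that by (cases "j = 2*N") auto
  ultimately show ?case by simp
qed

text \<open>A cluster tuple determines \<open>w_of\<close> only for 2 \<le> k \<le> 2N-2, and the
  recursion does not look beyond this range.\<close>

lemma tau_recursion_cong:
  assumes "N \<ge> 3" "\<And>k n. k \<in> {2..2*N-2} \<Longrightarrow> w k n = w' k n"
  shows "tau_recursion N b5 b6 \<tau> w r s \<longleftrightarrow> tau_recursion N b5 b6 \<tau> w' r s"
proof -
  have "tau_recursion N b5 b6 \<tau> w' r s"
    if "tau_recursion N b5 b6 \<tau> w r s" "\<And>k n. k \<in> {2..2*N-2} \<Longrightarrow> w k n = w' k n" for w w' :: "nat \<Rightarrow> nat \<Rightarrow> 'a"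
  proof -
    have ww: "w k = w' k" if "k \<in> {2..2*N-2}" for k
      using that \<open>\<And>k n. k \<in> {2..2*N-2} \<Longrightarrow> w k n = w' k n\<close> by blast
    have e: "w 2 = w' 2" "w 3 = w' 3" "w (2*N-2) = w' (2*N-2)" "w (2*N-3) = w' (2*N-3)"
      using assms(1) by (auto intro!: ww)
    have "w' k (n + 1) * w' k n = b5 * b6 * \<tau> (n + 2*N - 1) * \<tau> (n + 2*N) * \<tau> (n + k) * \<tau> (n + k + 1)
           + w' (k - 1) (n + 1) * w' (k + 1) n" if k: "3 \<le> k \<and> k \<le> 2*N - 3" for k n
    proof -
      have "w k (n + 1) * w k n = b5 * b6 * \<tau> (n + 2*N - 1) * \<tau> (n + 2*N) * \<tau> (n + k) * \<tau> (n + k + 1)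
           + w (k - 1) (n + 1) * w (k + 1) n"
        using \<open>tau_recursion N b5 b6 \<tau> w r s\<close> k unfolding tau_recursion_def by blast
      moreover have "w k = w' k" "w (k-1) = w' (k-1)" "w (k+1) = w' (k+1)" using k by (auto intro!: ww)
      ultimately show ?thesis by simp
    qed
    with that(1) show ?thesis unfolding tau_recursion_def e by blast
  qed
  with assms(2) show ?thesis by metis
qed

section \<open>The cluster tuple and its x-coordinates\<close>

lemma upt_split: "a \<le> b \<Longrightarrow> b \<le> c \<Longrightarrow> [a..<c] = [a..<b] @ [b..<c]"
  by (metis le_add_diff_inverse upt_add_eq_append)

lemma cluster_tuple_iff:
  assumes N: "N \<ge> 3"
  shows "map z [1..<4*N + 1] = cluster_tuple N \<xi> r s \<tau> \<chi> \<eta> n \<longleftrightarrow>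
     (\<forall>j\<le>2*N. z (t_node N j) = \<tau> (n + j)) \<and> (\<forall>k\<in>{2..2*N-2}. z (c_node N k) = w_of N \<chi> \<eta> \<xi> k n)
     \<and> z (N - 1) = r n \<and> z N = s n"
proof -
  \<comment> \<open>The first N-2 labels carry c_{N+1}, ..., c_{2N-2}, so the xi-index 2N-1-k
    decreases along them; hence the reversed list.\<close>
  have "[1..<N-1] = map (\<lambda>j. c_node N (2*N - 1 - j)) (rev [1..<N-1])"
    by (rule nth_equalityI) (use N in \<open>auto simp: rev_nth c_node_def\<close>)
  moreover have "[N+1..<3*N+2] = map (t_node N) [0..<2*N+1]"
    by (rule map_upt_eqI[symmetric]) (auto simp: t_node_def simp del: upt_Suc)
  moreover have "[3*N+3..<4*N+1] = map (\<lambda>j. c_node N (j + 2)) [1..<N-1]"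
    by (rule map_upt_eqI[symmetric]) (use N in \<open>auto simp: c_node_def simp del: upt_Suc\<close>)
  moreover have "[1..<4*N+1] = [1..<N-1] @ [N-1..<N+1] @ [N+1..<3*N+2] @ [3*N+2..<3*N+3] @ [3*N+3..<4*N+1]"
    using N upt_split[of 1 "N-1" "4*N+1"] upt_split[of "N-1" "N+1" "4*N+1"] upt_split[of "N+1" "3*N+2" "4*N+1"]
      upt_split[of "3*N+2" "3*N+3" "4*N+1"] by (simp del: upt_Suc)
  moreover have "[N-1..<N+1] = [N-1,N]" using N by (cases N) (auto simp: upt_rec)
  moreover have "[3*N+2..<3*N+3] = [c_node N 2]" using N by (simp add: c_node_def upt_rec)
  ultimately have l: "[1..<4*N+1] = map (\<lambda>j. c_node N (2*N - 1 - j)) (rev [1..<N-1]) @ [N-1,N] @ map (t_node N) [0..<2*N+1]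
     @ [c_node N 2] @ map (\<lambda>j. c_node N (j + 2)) [1..<N-1]" by metis
  have "map z [1..<4*N + 1] = cluster_tuple N \<xi> r s \<tau> \<chi> \<eta> n \<longleftrightarrow>
     (\<forall>j\<in>{1..<N-1}. z (c_node N (2*N - 1 - j)) = \<xi> j n) \<and> z (N-1) = r n \<and> z N = s n
       \<and> (\<forall>j\<in>{0..<2*N+1}. z (t_node N j) = \<tau> (n + j)) \<and> z (c_node N 2) = \<chi> n
       \<and> (\<forall>j\<in>{1..<N-1}. z (c_node N (j + 2)) = \<eta> j n)"
    unfolding l cluster_tuple_def by (simp add: comp_def del: upt_Suc)
  moreover have "(\<forall>k\<in>{2..2*N-2}. z (c_node N k) = w_of N \<chi> \<eta> \<xi> k n) \<longleftrightarrow>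
      z (c_node N 2) = \<chi> n \<and> (\<forall>j\<in>{1..<N-1}. z (c_node N (j + 2)) = \<eta> j n)
      \<and> (\<forall>j\<in>{1..<N-1}. z (c_node N (2*N - 1 - j)) = \<xi> j n)" (is "?L \<longleftrightarrow> ?R")
  proof
    assume L: ?L
    show ?R
    proof (intro conjI ballI)
      show "z (c_node N 2) = \<chi> n" using L N by (force simp: w_of_def)
      fix j assume j: "j \<in> {1..<N-1}"
      show "z (c_node N (j + 2)) = \<eta> j n" using L[rule_format, of "j+2"] j by (auto simp: w_of_def)
      have "2*N - 1 - j \<in> {2..2*N-2}" "2*N - 1 - j \<noteq> 2" "\<not> 2*N - 1 - j \<le> N" "2*N - 1 - (2*N - 1 - j) = j"
        using j by auto
      then show "z (c_node N (2*N - 1 - j)) = \<xi> j n" using L by (simp add: w_of_def)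
    qed
  next
    assume R: ?R
    show ?L
    proof
      fix k assume k: "k \<in> {2..2*N-2}"
      consider "k = 2" | "3 \<le> k" "k \<le> N" | "k > N" using k by fastforce
      then show "z (c_node N k) = w_of N \<chi> \<eta> \<xi> k n"
      proof cases
        case 1 then show ?thesis using R by (simp add: w_of_def)
      next
        case 2
        then have "k - 2 \<in> {1..<N-1}" "k - 2 + 2 = k" by auto
        with R have "z (c_node N k) = \<eta> (k - 2) n" by metis
        then show ?thesis using 2 by (simp add: w_of_def)
      next
        case 3
        then have "2*N - 1 - k \<in> {1..<N-1}" "2*N - 1 - (2*N - 1 - k) = k" using k by auto
        with R have "z (c_node N k) = \<xi> (2*N - 1 - k) n" by metis
        then show ?thesis using 3 N by (simp add: w_of_def)
      qed
    qed
  qed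
  moreover have "(\<forall>j\<in>{0..<2*N+1}. z (t_node N j) = \<tau> (n + j)) \<longleftrightarrow> (\<forall>j\<le>2*N. z (t_node N j) = \<tau> (n + j))"
    by auto
  ultimately show ?thesis by blast
qed

lemma cluster_tuple_cluster_iff:
  assumes N: "N \<ge> 3"
  shows "map (cluster_after N n) [1..<4*N + 1] = cluster_tuple N \<xi> r s \<tau> \<chi> \<eta> n \<longleftrightarrow>
     (\<forall>j\<le>2*N. \<tau> (n + j) = cluster_tau N (n + j)) \<and> (\<forall>k\<in>{2..2*N-2}. w_of N \<chi> \<eta> \<xi> k n = cluster_w N k n)
     \<and> r n = cluster_r N n \<and> s n = cluster_s N n"
proof -
  have "cluster_after N n (t_node N j) = cluster_tau N (n + j)" if "j \<le> 2*N" for j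
    using cluster_after_t_node[OF N that] by (simp add: cluster_tau_def)
  then have t: "(\<forall>j\<le>2*N. cluster_after N n (t_node N j) = \<tau> (n + j)) \<longleftrightarrow> (\<forall>j\<le>2*N. \<tau> (n + j) = cluster_tau N (n + j))"
    by metis
  show ?thesis
    unfolding cluster_tuple_iff[OF N] t cluster_w_def cluster_r_def cluster_s_def by metis
qed

lemma x_of_cluster_cluster_after:
  assumes N: "N \<ge> 3"
  shows "x_of_cluster N (cluster_after N n) = x_of N (cluster_tau N) (cluster_w N) (cluster_r N) (cluster_s N) n"
proof
  fix k
  have t: "cluster_after N n (t_node N j) = cluster_tau N (n + j)" if "j \<le> 2*N" for j
    using cluster_after_t_node[OF N that] by (simp add: cluster_tau_def)
  have "n + 2*N - 1 = n + (2*N - 1)" using N by auto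
  then show "x_of_cluster N (cluster_after N n) k = x_of N (cluster_tau N) (cluster_w N) (cluster_r N) (cluster_s N) n k"
    unfolding x_of_cluster_def x_of_def
    using t[of 0] t[of 1] t[of "2*N"] t[of "2*N-1"] t[of k] N
    by (simp add: cluster_w_def cluster_r_def cluster_s_def)
qed

text \<open>The existence clause complements the equivalence before it, which would also hold if no
  sequences satisfied either side. The last clause joins both halves: in x-coordinates
  \<open>psi\<close> acts as the deformed map, up to the swap.\<close>

theorem mainTheorem4:
  fixes N :: nat and b5 b6 :: "'a::field"
  assumes "N \<ge> 3"
  shows
    "(\<forall>n. quiver_after N n = QD N
        \<and> cluster_after N n (4*N + 1) = indet (4*N + 1)
        \<and> cluster_after N n (4*N + 2) = indet (4*N + 2))
   \<and> (\<forall>\<xi> r s \<tau> \<chi> \<eta>.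
        cluster_tuple N \<xi> r s \<tau> \<chi> \<eta> 0 = map indet [1..<4*N + 1]
          \<and> tau_recursion N (indet (4*N + 1)) (indet (4*N + 2)) \<tau> (w_of N \<chi> \<eta> \<xi>) r s
        \<longleftrightarrow> (\<forall>n. map (cluster_after N n) [1..<4*N + 1] = cluster_tuple N \<xi> r s \<tau> \<chi> \<eta> n))
   \<and> (\<exists>\<xi> r s \<tau> \<chi> \<eta>.
        \<forall>n. map (cluster_after N n) [1..<4*N + 1] = cluster_tuple N \<xi> r s \<tau> \<chi> \<eta> n)
   \<and> (\<forall>(\<tau> :: nat \<Rightarrow> 'a) w r s. (\<forall>n. \<tau> n \<noteq> 0) \<longrightarrow>
        (tau_recursion N b5 b6 \<tau> w r s \<longleftrightarrow>
         (\<forall>n. D_relations N b5 b6 (x_of N \<tau> w r s n) (swap_last N (x_of N \<tau> w r s (n + 1))))))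
   \<and> (\<forall>x x' :: nat \<Rightarrow> 'a. (\<forall>k\<in>{1..2*N}. x k \<noteq> 0) \<longrightarrow>
        (D_relations N b5 b6 x x' \<longleftrightarrow>
         (\<forall>k\<in>{1..2*N}. x' k = deformed_D_map (2*N) (D_params N b5 b6) (\<lambda>_. 1) x k)))
   \<and> (\<forall>n. \<forall>k\<in>{1..2*N}.
        swap_last N (x_of_cluster N (cluster_after N (n + 1))) k =
        deformed_D_map (2*N) (D_params N (indet (4*N + 1)) (indet (4*N + 2))) (\<lambda>_. 1)
          (x_of_cluster N (cluster_after N n)) k)"
proof (intro conjI)
  note N = assms
  have init: "cluster_after N 0 = indet" by (simp add: cluster_after_def init_seed_def)
  have nz: "cluster_tau N n \<noteq> 0" "cluster_r N n \<noteq> 0" "cluster_s N n \<noteq> 0"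
     "\<And>k. k \<in> {2..2*N-2} \<Longrightarrow> cluster_w N k n \<noteq> 0" for n
    using cluster_after_nonzero[OF N] by (simp_all add: cluster_tau_def cluster_r_def cluster_s_def cluster_w_def)
  note ct = cluster_tuple_cluster_iff[OF N]
  show "\<forall>n. quiver_after N n = QD N \<and> cluster_after N n (4*N + 1) = indet (4*N + 1)
        \<and> cluster_after N n (4*N + 2) = indet (4*N + 2)"
    using seed_after(1)[OF N] frozen_after[OF N] by (simp add: quiver_after_def)
  show "\<forall>\<xi> r s \<tau> \<chi> \<eta>.
        cluster_tuple N \<xi> r s \<tau> \<chi> \<eta> 0 = map indet [1..<4*N + 1]
          \<and> tau_recursion N (indet (4*N + 1)) (indet (4*N + 2)) \<tau> (w_of N \<chi> \<eta> \<xi>) r s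
        \<longleftrightarrow> (\<forall>n. map (cluster_after N n) [1..<4*N + 1] = cluster_tuple N \<xi> r s \<tau> \<chi> \<eta> n)"
  proof (intro allI iffI)
    fix \<xi> r s \<tau> \<chi> \<eta> n
    assume *: "cluster_tuple N \<xi> r s \<tau> \<chi> \<eta> 0 = map indet [1..<4*N + 1]
          \<and> tau_recursion N (indet (4*N + 1)) (indet (4*N + 2)) \<tau> (w_of N \<chi> \<eta> \<xi>) r s"
    then have "map (cluster_after N 0) [1..<4*N + 1] = cluster_tuple N \<xi> r s \<tau> \<chi> \<eta> 0"
      unfolding init by metis
    note i = this[unfolded ct]
    \<comment> \<open>The actual cluster variables serve as the non-vanishing solution in the
      uniqueness argument.\<close>
    show "map (cluster_after N n) [1..<4*N + 1] = cluster_tuple N \<xi> r s \<tau> \<chi> \<eta> n"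
      unfolding ct
      by (rule tau_recursion_unique[OF N conjunct2[OF *] tau_recursion_cluster[OF N] nz(1,4,2,3)])
         (use i in auto)
  next
    fix \<xi> r s \<tau> \<chi> \<eta>
    assume *: "\<forall>n. map (cluster_after N n) [1..<4*N + 1] = cluster_tuple N \<xi> r s \<tau> \<chi> \<eta> n"
    \<comment> \<open>The entry \<open>j = 0\<close> of each window determines \<open>\<tau>\<close>
      everywhere.\<close>
    have "\<tau> (n + 0) = cluster_tau N (n + 0)" "r n = cluster_r N n" "s n = cluster_s N n" for n
      using *[unfolded ct, rule_format, of n] by blast+
    then have e: "\<tau> = cluster_tau N" "r = cluster_r N" "s = cluster_s N" by auto
    have "tau_recursion N (indet (4*N + 1)) (indet (4*N + 2)) \<tau> (w_of N \<chi> \<eta> \<xi>) r s"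
      unfolding e using tau_recursion_cluster[OF N] tau_recursion_cong[OF N, of "w_of N \<chi> \<eta> \<xi>" "cluster_w N"] *[unfolded ct] by blast
    then show "cluster_tuple N \<xi> r s \<tau> \<chi> \<eta> 0 = map indet [1..<4*N + 1]
          \<and> tau_recursion N (indet (4*N + 1)) (indet (4*N + 2)) \<tau> (w_of N \<chi> \<eta> \<xi>) r s"
      using *[rule_format, of 0] unfolding init by metis
  qed
  show "\<exists>\<xi> r s \<tau> \<chi> \<eta>. \<forall>n. map (cluster_after N n) [1..<4*N + 1] = cluster_tuple N \<xi> r s \<tau> \<chi> \<eta> n"
  proof (intro exI allI)
    fix n
    \<comment> \<open>The witnesses invert the reindexing in \<open>w_of\<close>.\<close>
    have "w_of N (cluster_w N 2) (\<lambda>j. cluster_w N (j + 2)) (\<lambda>j. cluster_w N (2*N - 1 - j)) k n = cluster_w N k n"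
      if "k \<in> {2..2*N-2}" for k
    proof -
      obtain j where "k = j + 2" using \<open>k \<in> {2..2*N-2}\<close> by (metis atLeastAtMost_iff le_add_diff_inverse2)
      then show ?thesis using that by (auto simp: w_of_def numeral_2_eq_2)
    qed
    then show "map (cluster_after N n) [1..<4*N + 1] = cluster_tuple N (\<lambda>j. cluster_w N (2*N - 1 - j)) (cluster_r N) (cluster_s N)
        (cluster_tau N) (cluster_w N 2) (\<lambda>j. cluster_w N (j + 2)) n"
      unfolding ct by blast
  qed
  show "\<forall>(\<tau> :: nat \<Rightarrow> 'a) w r s. (\<forall>n. \<tau> n \<noteq> 0) \<longrightarrow>
        (tau_recursion N b5 b6 \<tau> w r s \<longleftrightarrow>
         (\<forall>n. D_relations N b5 b6 (x_of N \<tau> w r s n) (swap_last N (x_of N \<tau> w r s (n + 1)))))"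
    using tau_recursion_iff_D_relations[OF N] by blast
  show "\<forall>x x' :: nat \<Rightarrow> 'a. (\<forall>k\<in>{1..2*N}. x k \<noteq> 0) \<longrightarrow>
        (D_relations N b5 b6 x x' \<longleftrightarrow>
         (\<forall>k\<in>{1..2*N}. x' k = deformed_D_map (2*N) (D_params N b5 b6) (\<lambda>_. 1) x k))"
    using D_relations_iff_deformed_D_map[OF N] by blast
  show "\<forall>n. \<forall>k\<in>{1..2*N}.
        swap_last N (x_of_cluster N (cluster_after N (n + 1))) k =
        deformed_D_map (2*N) (D_params N (indet (4*N + 1)) (indet (4*N + 2))) (\<lambda>_. 1)
          (x_of_cluster N (cluster_after N n)) k"
  proof
    fix n
    \<comment> \<open>The coordinates are quotients of nonzero cluster variables, so the implicit
      relations can be solved and become the map.\<close>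
    have "x_of_cluster N (cluster_after N n) k \<noteq> 0" if "k \<in> {1..2*N}" for k
      unfolding x_of_cluster_cluster_after[OF N] x_of_def using that nz by auto
    moreover have "D_relations N (indet (4*N + 1)) (indet (4*N + 2)) (x_of_cluster N (cluster_after N n))
        (swap_last N (x_of_cluster N (cluster_after N (n + 1))))"
      unfolding x_of_cluster_cluster_after[OF N]
      using tau_recursion_iff_D_relations[OF N, of "cluster_tau N"] nz(1) tau_recursion_cluster[OF N] by blast
    ultimately show "\<forall>k\<in>{1..2*N}.
        swap_last N (x_of_cluster N (cluster_after N (n + 1))) k =
        deformed_D_map (2*N) (D_params N (indet (4*N + 1)) (indet (4*N + 2))) (\<lambda>_. 1)
          (x_of_cluster N (cluster_after N n)) k"
      using D_relations_iff_deformed_D_map[OF N] by blast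
  qed
qed

end
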